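(* Let $\mathbb{K}$ be a field, $R=\mathbb{K}[X_1,\dots,X_n]$ with its standard $\mathbb{Z}^n$-grading, $M$ a finitely generated $\mathbb{Z}^n$-graded $R$-module that is positively $\mathbf{g}$-determined for some $\mathbf{g}\in\mathbb{N}^n$, and $(R_i,\mathbf{s}_i)_{i\in I}$ a $\mathbf{g}$-determined Hilbert decomposition of $M$. Let $(A_{\mathbf{a}})_{\mathbf{a}\in[\mathbf{0},\mathbf{g}]}$ be the square matrices with entries in $\mathbb{K}[Y_{i,j} : (i,j)\in\tilde I]$ constructed from this Hilbert decomposition as described in the context. Then: (a) Assume $|\mathbb{K}|=\infty$. Then the given Hilbert decomposition of $M$ is induced by a Stanley decomposition of $M$ if and only if $\det A_{\mathbf{a}}$ is not the zero polynomial for all $\mathbf{a}\in[\mathbf{0},\mathbf{g}]$. (b) Assume $|\mathbb{K}|=q<\infty$. Let $P:=\prod_{\mathbf{a}\in[\mathbf{0},\mathbf{g}]}\det A_{\mathbf{a}}$, and let $\tilde P$ be the polynomial obtained from $P$ as follows: from every exponent of every monomial in $P$, subtract $q-1$ until the remainder is less than $q$. Then the given Hilbert decomposition of $M$ is induced by a Stanley decomposition of $M$ if and only if $\tilde P\neq 0$.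
   Context: Notation: $[n]=\{1,\dots,n\}$; $\preceq$ is the componentwise order on $\mathbb{Z}^n$; $[\mathbf{a},\mathbf{b}]=\{\mathbf{c}\in\mathbb{Z}^n : \mathbf{a}\preceq\mathbf{c}\preceq\mathbf{b}\}$; $\mathbf{e}_k$ is the $k$-th unit vector; $\mathbf{X}^{\mathbf{a}}=X_1^{a_1}\cdots X_n^{a_n}$; $\mathbb{N}$ contains $0$. Positively $\mathbf{g}$-determined: $M_{\mathbf{a}}=0$ for $\mathbf{a}\notin\mathbb{N}^n$, and multiplication by $X_k$, $M_{\mathbf{a}}\to M_{\mathbf{a}+\mathbf{e}_k}$, is an isomorphism whenever $a_k\ge g_k$. Hilbert decomposition of $M$: a finite family $(R_i,\mathbf{s}_i)_{i\in I}$ with $\mathbf{s}_i\in\mathbb{Z}^n$ and each $R_i=\mathbb{K}[X_j : j\in Z_i]$ ($Z_i\subseteq[n]$) a subalgebra of $R$ generated by a subset of the indeterminates, such that $M\cong\bigoplus_{i\in I}R_i(-\mathbf{s}_i)$ as multigraded $\mathbb{K}$-vector spaces. When $M$ is positively $\mathbf{g}$-determined, the decomposition is called $\mathbf{g}$-determined if $\mathbf{s}_i\preceq\mathbf{g}$ for all $i\in I$ (equivalently, $\{j : (\mathbf{s}_i)_j=g_j\}\subseteq Z_i$ for all $i\in I$). Stanley decomposition of $M$: a finite family $(R_i,m_i)_{i\in I}$ with $m_i\in M$ homogeneous and $R_i$ subalgebras of $R$ generated by subsets of the indeterminates, such that $R_i\cap\operatorname{Ann} m_i=0$ for each $i$ and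 $M=\bigoplus_{i\in I}m_iR_i$ as a multigraded $\mathbb{K}$-vector space. A Hilbert decomposition $(R_i,\mathbf{s}_i)_{i\in I}$ is induced by a Stanley decomposition if there is a Stanley decomposition $(R_i,m_i)_{i\in I}$ of $M$ with $\deg m_i=\mathbf{s}_i$ for all $i\in I$. Construction of the matrices: for $\mathbf{a}\in\mathbb{N}^n$ let $\mathcal{C}(\mathbf{a})=\{i\in I : (R_i(-\mathbf{s}_i))_{\mathbf{a}}\neq 0\}$. For each $\mathbf{a}\in[\mathbf{0},\mathbf{g}]$ choose a $\mathbb{K}$-basis $b_{\mathbf{a},1},\dots,b_{\mathbf{a},l_{\mathbf{a}}}$ of $M_{\mathbf{a}}$. Let $\tilde I=\{(i,j) : i\in I,\ 1\le j\le l_{\mathbf{s}_i}\}$ and take indeterminates $Y_{i,j}$ for $(i,j)\in\tilde I$. For $i\in I$ set $\tilde m_i=\sum_j Y_{i,j}b_{\mathbf{s}_i,j}$. The matrix $A_{\mathbf{a}}$ has one row for each basis vector $b_{\mathbf{a},k}$ of $M_{\mathbf{a}}$ and one column for each $i\in\mathcal{C}(\mathbf{a})$; the column of $i$ consists of the coefficients of $\mathbf{X}^{\mathbf{a}-\mathbf{s}_i}\tilde m_i$ in the chosen basis. Explicitly, if $\mathbf{X}^{\mathbf{a}-\mathbf{s}_i}b_{\mathbf{s}_i,j}=\sum_k c_{j,k}b_{\mathbf{a},k}$ with $c_{j,k}\in\mathbb{K}$ (depending on $\mathbf{a}$ and $i$), then the entry in row $k$ and column $i$ is $\sum_j c_{j,k}Y_{i,j}$.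 These matrices are square because $|\mathcal{C}(\mathbf{a})|=\dim_{\mathbb{K}}M_{\mathbf{a}}$ (the determinant of an empty matrix is $1$). *)

theory Defs
  imports
    "HOL-Library.Poly_Mapping"
    "HOL-Library.Function_Algebras"
    "Jordan_Normal_Form.Determinant"
begin

text \<open>
  The indeterminates of \<open>R\<close> are indexed by a finite type \<open>'n\<close>, and \<open>\<int>\<^sup>n\<close> is the type
  \<open>'n \<Rightarrow> int\<close> with pointwise operations and the pointwise order.
\<close>

type_synonym ('x, 'k) mpoly = "('x \<Rightarrow>\<^sub>0 nat) \<Rightarrow>\<^sub>0 'k"

definition const :: "'k::zero \<Rightarrow> ('x, 'k) mpoly" where
  "const c = Poly_Mapping.single 0 c"

definition var :: "'x \<Rightarrow> ('x, 'k::zero_neq_one) mpoly" where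
  "var x = Poly_Mapping.single (Poly_Mapping.single x 1) 1"

definition mdeg :: "('n \<Rightarrow>\<^sub>0 nat) \<Rightarrow> 'n \<Rightarrow> int" where
  "mdeg t = (\<lambda>k. int (Poly_Mapping.lookup t k))"

definition unit_vec :: "'n \<Rightarrow> 'n \<Rightarrow> int" where
  "unit_vec k = (\<lambda>j. if j = k then 1 else 0)"

text \<open>The monomial \<open>X\<^sup>a\<close>; only meaningful for \<open>0 \<le> a\<close>.\<close>

definition X_pow :: "('n::finite \<Rightarrow> int) \<Rightarrow> ('n, 'k::zero_neq_one) mpoly" where
  "X_pow a = Poly_Mapping.single (Abs_poly_mapping (\<lambda>k. nat (a k))) 1"

definition subalg :: "'n set \<Rightarrow> ('n, 'k::zero) mpoly set" where
  "subalg Z = {p. \<forall>t\<in>Poly_Mapping.keys p. Poly_Mapping.keys t \<subseteq> Z}"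

text \<open>The component of degree \<open>a\<close> of the shifted algebra \<open>K[X\<^sub>j : j \<in> Z](-s)\<close>.\<close>

definition shift_comp :: "'n set \<Rightarrow> ('n \<Rightarrow> int) \<Rightarrow> ('n \<Rightarrow> int) \<Rightarrow> ('n, 'k::zero) mpoly set" where
  "shift_comp Z s a = {p \<in> subalg Z. \<forall>t\<in>Poly_Mapping.keys p. mdeg t = a - s}"

definition internal_direct_sum :: "'j set \<Rightarrow> ('j \<Rightarrow> 'm::ab_group_add set) \<Rightarrow> bool" where
  "internal_direct_sum J N \<longleftrightarrow>
     (\<forall>m. \<exists>!f. (\<forall>j\<in>J. f j \<in> N j) \<and> (\<forall>j. j \<notin> J \<longrightarrow> f j = 0) \<and>
               finite {j. f j \<noteq> 0} \<and> (\<Sum>j | f j \<noteq> 0. f j) = m)"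

text \<open>
  A module over \<open>R\<close> is a type \<open>'m\<close> with a scalar multiplication by polynomials. Its
  underlying vector space over \<open>K\<close> has the following scalar multiplication.
\<close>

definition kscale ::
  "(('n, 'k::field) mpoly \<Rightarrow> 'm::ab_group_add \<Rightarrow> 'm) \<Rightarrow> 'k \<Rightarrow> 'm \<Rightarrow> 'm" where
  "kscale scale c = scale (const c)"

locale graded_module = Modules.module scale
  for scale :: "('n::finite, 'k::field) mpoly \<Rightarrow> 'm::ab_group_add \<Rightarrow> 'm" +
  fixes gr :: "('n \<Rightarrow> int) \<Rightarrow> 'm set"
  assumes gr_subspace: "Modules.module.subspace (kscale scale) (gr a)"
    and gr_direct_sum: "internal_direct_sum UNIV gr"
    and gr_scale: "m \<in> gr a \<Longrightarrow> scale (Poly_Mapping.single t c) m \<in> gr (a + mdeg t)"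

definition finitely_generated ::
  "(('n::finite, 'k::field) mpoly \<Rightarrow> 'm::ab_group_add \<Rightarrow> 'm) \<Rightarrow> bool" where
  "finitely_generated scale \<longleftrightarrow> (\<exists>S. finite S \<and> Modules.module.span scale S = UNIV)"

definition positively_determined ::
  "(('n::finite, 'k::field) mpoly \<Rightarrow> 'm::ab_group_add \<Rightarrow> 'm) \<Rightarrow>
   (('n \<Rightarrow> int) \<Rightarrow> 'm set) \<Rightarrow> ('n \<Rightarrow> int) \<Rightarrow> bool" where
  "positively_determined scale gr g \<longleftrightarrow>
     (\<forall>a. \<not> 0 \<le> a \<longrightarrow> gr a = {0}) \<and>
     (\<forall>a k. g k \<le> a k \<longrightarrow> bij_betw (scale (var k)) (gr a) (gr (a + unit_vec k)))"

text \<open>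
  The family \<open>(R\<^sub>i, s\<^sub>i)\<close>, \<open>i \<in> I\<close>, is given by \<open>Z\<close> and \<open>s\<close> with \<open>R\<^sub>i = subalg (Z i)\<close>.
  The external direct sum of the \<open>R\<^sub>i(-s\<^sub>i)\<close> consists of the functions on \<open>I\<close>, extended by
  \<open>0\<close> outside \<open>I\<close>.
\<close>

definition hilbert_decomposition ::
  "(('n::finite, 'k::field) mpoly \<Rightarrow> 'm::ab_group_add \<Rightarrow> 'm) \<Rightarrow>
   (('n \<Rightarrow> int) \<Rightarrow> 'm set) \<Rightarrow> 'i set \<Rightarrow> ('i \<Rightarrow> 'n set) \<Rightarrow> ('i \<Rightarrow> 'n \<Rightarrow> int) \<Rightarrow> bool" where
  "hilbert_decomposition scale gr I Z s \<longleftrightarrow> finite I \<and>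
     (\<exists>\<phi> :: 'm \<Rightarrow> 'i \<Rightarrow> ('n, 'k) mpoly.
        Vector_Spaces.linear (kscale scale) (\<lambda>c f i. const c * f i) \<phi> \<and>
        bij_betw \<phi> UNIV {f. (\<forall>i\<in>I. f i \<in> subalg (Z i)) \<and> (\<forall>i. i \<notin> I \<longrightarrow> f i = 0)} \<and>
        (\<forall>a. \<phi> ` gr a =
           {f. (\<forall>i\<in>I. f i \<in> shift_comp (Z i) (s i) a) \<and> (\<forall>i. i \<notin> I \<longrightarrow> f i = 0)}))"

text \<open>
  No compatibility of the direct sum with the grading has to be required: the summands are
  graded subspaces because the \<open>m\<^sub>i\<close> are homogeneous.
\<close>

definition stanley_decomposition ::
  "(('n::finite, 'k::field) mpoly \<Rightarrow> 'm::ab_group_add \<Rightarrow> 'm) \<Rightarrow>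
   (('n \<Rightarrow> int) \<Rightarrow> 'm set) \<Rightarrow> 'i set \<Rightarrow> ('i \<Rightarrow> 'n set) \<Rightarrow> ('i \<Rightarrow> 'm) \<Rightarrow> bool" where
  "stanley_decomposition scale gr I Z m \<longleftrightarrow> finite I \<and>
     (\<forall>i\<in>I. \<exists>a. m i \<in> gr a) \<and>
     (\<forall>i\<in>I. subalg (Z i) \<inter> {p. scale p (m i) = 0} = {0}) \<and>
     internal_direct_sum I (\<lambda>i. (\<lambda>p. scale p (m i)) ` subalg (Z i))"

text \<open>The \<open>m\<^sub>i\<close> are nonzero by the annihilator condition, so \<open>m i \<in> gr (s i)\<close> says \<open>deg m\<^sub>i = s\<^sub>i\<close>.\<close>

definition induced_by_stanley ::
  "(('n::finite, 'k::field) mpoly \<Rightarrow> 'm::ab_group_add \<Rightarrow> 'm) \<Rightarrow>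
   (('n \<Rightarrow> int) \<Rightarrow> 'm set) \<Rightarrow> 'i set \<Rightarrow> ('i \<Rightarrow> 'n set) \<Rightarrow> ('i \<Rightarrow> 'n \<Rightarrow> int) \<Rightarrow> bool" where
  "induced_by_stanley scale gr I Z s \<longleftrightarrow>
     (\<exists>m. stanley_decomposition scale gr I Z m \<and> (\<forall>i\<in>I. m i \<in> gr (s i)))"

definition occurring ::
  "'k::field itself \<Rightarrow> 'i set \<Rightarrow> ('i \<Rightarrow> 'n set) \<Rightarrow> ('i \<Rightarrow> 'n \<Rightarrow> int) \<Rightarrow> ('n \<Rightarrow> int) \<Rightarrow> 'i set" where
  "occurring _ I Z s a = {i \<in> I. (shift_comp (Z i) (s i) a :: ('n, 'k) mpoly set) \<noteq> {0}}"

definition k_basis_of ::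
  "(('n::finite, 'k::field) mpoly \<Rightarrow> 'm::ab_group_add \<Rightarrow> 'm) \<Rightarrow> 'm set \<Rightarrow> 'm list \<Rightarrow> bool" where
  "k_basis_of scale V bs \<longleftrightarrow> distinct bs \<and>
     \<not> Modules.module.dependent (kscale scale) (set bs) \<and>
     Modules.module.span (kscale scale) (set bs) = V"

text \<open>
  The matrix \<open>A\<^sub>a\<close> for the bases \<open>b\<close> and the list \<open>cs\<close> of column labels (an enumeration of
  \<open>C(a)\<close>). Rows, columns and basis vectors are numbered from \<open>0\<close>, so the indeterminates are
  \<open>Y (i, j)\<close> with \<open>j < l\<close> where \<open>l\<close> is the dimension of the component of degree \<open>s i\<close>.
  The determinant of a non-square matrix is \<open>0\<close> in the library, but the
  matrices arising from a Hilbert decomposition are square.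
\<close>

definition A_matrix ::
  "(('n::finite, 'k::field) mpoly \<Rightarrow> 'm::ab_group_add \<Rightarrow> 'm) \<Rightarrow>
   (('n \<Rightarrow> int) \<Rightarrow> 'm list) \<Rightarrow> ('i \<Rightarrow> 'n \<Rightarrow> int) \<Rightarrow> 'i list \<Rightarrow> ('n \<Rightarrow> int) \<Rightarrow>
   ('i \<times> nat, 'k) mpoly mat" where
  "A_matrix scale b s cs a = Matrix.mat (length (b a)) (length cs) (\<lambda>(k, c).
     let i = cs ! c in
     \<Sum>j<length (b (s i)).
       const (Modules.module.representation (kscale scale) (set (b a))
                (scale (X_pow (a - s i)) (b (s i) ! j)) (b a ! k))
       * var (i, j))"

text \<open>
  Subtract \<open>q - 1\<close> until the result is less than \<open>q\<close>; the guard \<open>q \<le> 1\<close> (no field has such a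
  cardinality) is only there for termination.
\<close>

function reduce_exp :: "nat \<Rightarrow> nat \<Rightarrow> nat" where
  "reduce_exp q e = (if e < q \<or> q \<le> 1 then e else reduce_exp q (e - (q - 1)))"
  by auto
termination by (relation "measure snd") auto

declare reduce_exp.simps [simp del]

text \<open>The function may merge monomials, whose coefficients are then added.\<close>

definition reduce_poly :: "nat \<Rightarrow> ('y, 'k::comm_monoid_add) mpoly \<Rightarrow> ('y, 'k) mpoly" where
  "reduce_poly q p = (\<Sum>t\<in>Poly_Mapping.keys p.
     Poly_Mapping.single (Poly_Mapping.map (reduce_exp q) t) (Poly_Mapping.lookup p t))"

end

theory Submission
  imports Defs
begin

text \<open>
  Elements \<open>m\<^sub>i\<close> of degree \<open>s\<^sub>i\<close> form a Stanley decomposition inducing the given Hilbert decomposition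
  iff, in every degree \<open>a\<close>, the elements \<open>X\<^sup>a\<^sup>-\<^sup>s\<^sup>i m\<^sub>i\<close>, \<open>i \<in> C(a)\<close>, are linearly independent: since
  \<open>\<bar>C(a)\<bar> = dim M\<^sub>a\<close>, they then form a basis of \<open>M\<^sub>a\<close>. It suffices to look at \<open>a \<in> [0,g]\<close>, because
  multiplication by \<open>X\<^sup>b\<close>, \<open>b = a - inf a g\<close>, maps the component of degree \<open>inf a g\<close> isomorphically
  onto \<open>M\<^sub>a\<close>, and \<open>C(a) = C(inf a g)\<close>. There, independence means that \<open>det A\<^sub>a\<close> does
  not vanish at the point \<open>y\<close> given by the coordinates of the \<open>m\<^sub>i\<close>. So everything reduces to the
  existence of a common non-root of finitely many polynomials: over an infinite field it exists iff
  all of them are nonzero; over a field with \<open>q\<close> elements, \<open>y\<^sup>q = y\<close> allows the reduction of the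
  exponents of the product, and a polynomial with all exponents less than \<open>q\<close> is zero iff it
  vanishes as a function.
\<close>

subsection \<open>Evaluation of multivariate polynomials\<close>

lemma poly_mapping_sum_single:
  "p = (\<Sum>t\<in>Poly_Mapping.keys p. Poly_Mapping.single t (Poly_Mapping.lookup p t))"
  by (rule poly_mapping_eqI)
     (simp add: lookup_sum lookup_single when_def in_keys_iff)

definition monom_eval :: "('x \<Rightarrow> 'k) \<Rightarrow> ('x \<Rightarrow>\<^sub>0 nat) \<Rightarrow> 'k::comm_ring_1" where
  "monom_eval y t = (\<Prod>x\<in>Poly_Mapping.keys t. y x ^ Poly_Mapping.lookup t x)"

definition poly_eval :: "('x \<Rightarrow> 'k) \<Rightarrow> ('x, 'k) mpoly \<Rightarrow> 'k::comm_ring_1" where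
  "poly_eval y p = (\<Sum>t\<in>Poly_Mapping.keys p. Poly_Mapping.lookup p t * monom_eval y t)"

text \<open>Monomials with different supports have to be evaluated over a common set of variables
  before they can be multiplied or compared.\<close>

lemma monom_eval_superset:
  assumes "finite V" "Poly_Mapping.keys t \<subseteq> V"
  shows "monom_eval y t = (\<Prod>x\<in>V. y x ^ Poly_Mapping.lookup t x)"
  unfolding monom_eval_def
  by (rule prod.mono_neutral_left) (use assms in \<open>auto simp: in_keys_iff\<close>)

lemma monom_eval_0 [simp]: "monom_eval y 0 = 1"
  by (simp add: monom_eval_def)

lemma monom_eval_single [simp]: "monom_eval y (Poly_Mapping.single x n) = y x ^ n"
  by (simp add: monom_eval_def)

lemma monom_eval_add: "monom_eval y (t + u) = monom_eval y t * monom_eval y u"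
proof -
  let ?V = "Poly_Mapping.keys t \<union> Poly_Mapping.keys u"
  have "Poly_Mapping.keys (t + u) \<subseteq> ?V"
    by (rule Poly_Mapping.keys_add)
  then have "monom_eval y (t + u) = (\<Prod>x\<in>?V. y x ^ Poly_Mapping.lookup (t + u) x)"
    by (intro monom_eval_superset) auto
  also have "\<dots> = (\<Prod>x\<in>?V. y x ^ Poly_Mapping.lookup t x) * (\<Prod>x\<in>?V. y x ^ Poly_Mapping.lookup u x)"
    by (simp add: lookup_add power_add prod.distrib)
  also have "\<dots> = monom_eval y t * monom_eval y u"
    by (simp add: monom_eval_superset[symmetric])
  finally show ?thesis .
qed

lemma poly_eval_superset:
  assumes "finite T" "Poly_Mapping.keys p \<subseteq> T"
  shows "poly_eval y p = (\<Sum>t\<in>T. Poly_Mapping.lookup p t * monom_eval y t)"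
  unfolding poly_eval_def
  by (rule sum.mono_neutral_left) (use assms in \<open>auto simp: in_keys_iff\<close>)

lemma poly_eval_0 [simp]: "poly_eval y 0 = 0"
  by (simp add: poly_eval_def)

lemma poly_eval_single [simp]: "poly_eval y (Poly_Mapping.single t c) = c * monom_eval y t"
  by (simp add: poly_eval_def)

lemma poly_eval_add: "poly_eval y (p + q) = poly_eval y p + poly_eval y q"
proof -
  let ?T = "Poly_Mapping.keys p \<union> Poly_Mapping.keys q"
  have "Poly_Mapping.keys (p + q) \<subseteq> ?T"
    by (rule Poly_Mapping.keys_add)
  then have "poly_eval y (p + q) = (\<Sum>t\<in>?T. Poly_Mapping.lookup (p + q) t * monom_eval y t)"
    by (intro poly_eval_superset) auto
  also have "\<dots> = (\<Sum>t\<in>?T. Poly_Mapping.lookup p t * monom_eval y t)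
      + (\<Sum>t\<in>?T. Poly_Mapping.lookup q t * monom_eval y t)"
    by (simp add: lookup_add algebra_simps sum.distrib)
  also have "\<dots> = poly_eval y p + poly_eval y q"
    by (simp add: poly_eval_superset[symmetric])
  finally show ?thesis .
qed

lemma poly_eval_sum: "poly_eval y (\<Sum>i\<in>S. f i) = (\<Sum>i\<in>S. poly_eval y (f i))"
  by (induction S rule: infinite_finite_induct) (simp_all add: poly_eval_add)

lemma poly_eval_mult: "poly_eval y (p * q) = poly_eval y p * poly_eval y q"
proof -
  have "p * q = (\<Sum>t\<in>Poly_Mapping.keys p. \<Sum>u\<in>Poly_Mapping.keys q.
      Poly_Mapping.single (t + u) (Poly_Mapping.lookup p t * Poly_Mapping.lookup q u))"
    by (subst sum_product[symmetric, where f = "\<lambda>t. Poly_Mapping.single t (Poly_Mapping.lookup p t)"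
          and g = "\<lambda>u. Poly_Mapping.single u (Poly_Mapping.lookup q u)", unfolded mult_single])
       (simp flip: poly_mapping_sum_single)
  then have "poly_eval y (p * q) = (\<Sum>t\<in>Poly_Mapping.keys p. \<Sum>u\<in>Poly_Mapping.keys q.
      Poly_Mapping.lookup p t * Poly_Mapping.lookup q u * (monom_eval y t * monom_eval y u))"
    by (simp only: poly_eval_sum poly_eval_single monom_eval_add)
  also have "\<dots> = poly_eval y p * poly_eval y q"
    by (simp add: poly_eval_def sum_product mult_ac)
  finally show ?thesis .
qed

lemma poly_eval_1 [simp]: "poly_eval y 1 = 1"
  by (simp flip: single_one)

lemma poly_eval_const [simp]: "poly_eval y (const c) = c"
  by (simp add: const_def)

lemma poly_eval_var [simp]: "poly_eval y (var x) = y x"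
  by (simp add: var_def)

lemma comm_ring_hom_poly_eval: "comm_ring_hom (poly_eval y)"
  by unfold_locales (simp_all add: poly_eval_add poly_eval_mult)

lemma poly_eval_prod: "poly_eval y (\<Prod>i\<in>S. f i) = (\<Prod>i\<in>S. poly_eval y (f i))"
  by (induction S rule: infinite_finite_induct) (simp_all add: poly_eval_mult)

subsection \<open>Points where polynomials do not vanish\<close>

text \<open>A nonzero polynomial of degree less than \<open>N\<close> has fewer than
  \<open>N\<close> roots.\<close>

lemma univariate_coeffs_eq_0:
  fixes a :: "nat \<Rightarrow> 'k::idom"
  assumes "finite S" "N \<le> card S" "\<And>x. x \<in> S \<Longrightarrow> (\<Sum>e<N. a e * x ^ e) = 0" "e < N"
  shows "a e = 0"
proof -
  define p where "p = (\<Sum>e<N. Polynomial.monom (a e) e)"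
  have coeff: "coeff p k = (if k < N then a k else 0)" for k
    by (simp add: p_def coeff_sum)
  have roots: "S \<subseteq> {x. poly p x = 0}"
    using assms(3) by (auto simp: p_def poly_sum poly_monom)
  have "p = 0"
  proof (rule ccontr)
    assume "p \<noteq> 0"
    then have "card S \<le> card {x. poly p x = 0}"
      by (intro card_mono poly_roots_finite roots)
    also have "\<dots> \<le> degree p"
      using \<open>p \<noteq> 0\<close> by (rule card_poly_roots_bound)
    also have "degree p < N"
      using coeff \<open>p \<noteq> 0\<close> by (metis leading_coeff_0_iff)
    finally show False
      using assms(2) by simp
  qed
  then show ?thesis
    using coeff[of e] assms(4) by simp
qed

text \<open>The exponent vectors \<open>ex t\<close> need only be distinct on \<open>V\<close>: this is what survives when a
  variable is removed from \<open>V\<close> and the terms are grouped by their exponent in it.\<close>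

lemma vanishing_on_grid:
  fixes c :: "'t \<Rightarrow> 'k::idom" and ex :: "'t \<Rightarrow> 'x \<Rightarrow> nat"
  assumes "finite V" "finite S" "finite T"
    and "\<And>t x. t \<in> T \<Longrightarrow> x \<in> V \<Longrightarrow> ex t x < card S"
    and "\<And>t u. t \<in> T \<Longrightarrow> u \<in> T \<Longrightarrow> (\<forall>x\<in>V. ex t x = ex u x) \<Longrightarrow> t = u"
    and "\<And>y. (\<forall>x. y x \<in> S) \<Longrightarrow> (\<Sum>t\<in>T. c t * (\<Prod>x\<in>V. y x ^ ex t x)) = 0"
    and "S \<noteq> {}" "t \<in> T"
  shows "c t = 0"
  using assms(1,3-)
proof (induction V arbitrary: T t)
  case empty
  \<comment> \<open>Without variables all exponent vectors agree, so \<open>T\<close> has one term,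
    and evaluation at any point of the grid gives its coefficient.\<close>
  then have "T = {t}"
    by auto
  then show ?case
    using empty.prems(4)[of "\<lambda>_. SOME x. x \<in> S"] \<open>S \<noteq> {}\<close> by (simp add: some_in_eq)
next
  case (insert v V)
  \<comment> \<open>With the other variables fixed, the sum is a univariate polynomial in the value
    of \<open>v\<close> whose coefficient at exponent \<open>e\<close> collects the terms in
    \<open>U e\<close>; it has degree below \<open>card S\<close> and vanishes on
    \<open>S\<close>.\<close>
  define U where "U e = {u \<in> T. ex u v = e}" for e
  have "(\<Sum>u\<in>U e. c u * (\<Prod>x\<in>V. y x ^ ex u x)) = 0" if y: "\<forall>x. y x \<in> S" and e: "e < card S" for y e
  proof (rule univariate_coeffs_eq_0[OF \<open>finite S\<close> order_refl _ e])
    fix z assume "z \<in> S"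
    define y' where "y' = y(v := z)"
    have *: "(\<Prod>x\<in>V. y' x ^ ex u x) = (\<Prod>x\<in>V. y x ^ ex u x)" for u
      using insert.hyps by (intro prod.cong) (auto simp: y'_def)
    have "(\<Sum>e<card S. (\<Sum>u\<in>U e. c u * (\<Prod>x\<in>V. y x ^ ex u x)) * z ^ e)
        = (\<Sum>e<card S. \<Sum>u\<in>U e. c u * (\<Prod>x\<in>insert v V. y' x ^ ex u x))"
    proof (intro sum.cong refl)
      fix e
      have "c u * (\<Prod>x\<in>insert v V. y' x ^ ex u x) = c u * (\<Prod>x\<in>V. y x ^ ex u x) * z ^ e"
        if "u \<in> U e" for u
      proof -
        have "y' v ^ ex u v = z ^ e"
          using that by (simp add: y'_def U_def)
        then show ?thesis
          using insert.hyps by (simp add: * mult_ac)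
      qed
      then show "(\<Sum>u\<in>U e. c u * (\<Prod>x\<in>V. y x ^ ex u x)) * z ^ e
          = (\<Sum>u\<in>U e. c u * (\<Prod>x\<in>insert v V. y' x ^ ex u x))"
        by (simp only: sum_distrib_right cong: sum.cong)
    qed
    also have "\<dots> = (\<Sum>u\<in>T. c u * (\<Prod>x\<in>insert v V. y' x ^ ex u x))"
      unfolding U_def using insert.prems(1,2) by (intro sum.group) auto
    also have "\<dots> = 0"
      using y \<open>z \<in> S\<close> by (intro insert.prems(4)) (auto simp: y'_def)
    finally show "(\<Sum>e<card S. (\<Sum>u\<in>U e. c u * (\<Prod>x\<in>V. y x ^ ex u x)) * z ^ e) = 0" .
  qed
  then have *: "(\<Sum>u\<in>U (ex t v). c u * (\<Prod>x\<in>V. y x ^ ex u x)) = 0" if "\<forall>x. y x \<in> S" for y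
    using that insert.prems by auto
  show ?case
  proof (rule insert.IH[of "U (ex t v)"])
    show "u = u'" if "u \<in> U (ex t v)" "u' \<in> U (ex t v)" "\<forall>x\<in>V. ex u x = ex u' x" for u u'
      using that insert.prems(3)[of u u'] by (auto simp: U_def)
  qed (use insert.prems * in \<open>auto simp: U_def\<close>)
qed

text \<open>The grid is the whole field in every coordinate: exponents below its cardinality are
  exactly what the grid argument allows.\<close>

lemma poly_eval_nonzero_finite:
  fixes p :: "('x, 'k::{idom}) mpoly"
  assumes "finite (UNIV :: 'k set)" "p \<noteq> 0"
    and "\<And>t x. t \<in> Poly_Mapping.keys p \<Longrightarrow> Poly_Mapping.lookup t x < card (UNIV :: 'k set)"
  obtains y where "poly_eval y p \<noteq> 0"
proof -
  obtain t where t: "t \<in> Poly_Mapping.keys p"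
    using assms(2) by fastforce
  define V where "V = (\<Union>t\<in>Poly_Mapping.keys p. Poly_Mapping.keys t)"
  have fin: "finite V"
    by (simp add: V_def)
  have *: "monom_eval y t = (\<Prod>x\<in>V. y x ^ Poly_Mapping.lookup t x)" if "t \<in> Poly_Mapping.keys p" for y t
    by (rule monom_eval_superset) (use that fin in \<open>auto simp: V_def\<close>)
  have "\<exists>y. poly_eval y p \<noteq> 0"
  proof (rule ccontr)
    assume "\<not> ?thesis"
    then have "(\<Sum>t\<in>Poly_Mapping.keys p. Poly_Mapping.lookup p t * (\<Prod>x\<in>V. y x ^ Poly_Mapping.lookup t x)) = 0" for y
      by (simp add: poly_eval_def * cong: sum.cong)
    \<comment> \<open>Variables outside \<open>V\<close> have exponent 0 in every monomial of
      \<open>p\<close>, so agreement on \<open>V\<close> is equality.\<close>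
    moreover have "t = u" if "t \<in> Poly_Mapping.keys p" "u \<in> Poly_Mapping.keys p"
        "\<forall>x\<in>V. Poly_Mapping.lookup t x = Poly_Mapping.lookup u x" for t u
    proof (rule poly_mapping_eqI)
      fix x show "Poly_Mapping.lookup t x = Poly_Mapping.lookup u x"
        using that by (cases "x \<in> V") (auto simp: V_def in_keys_iff)
    qed
    ultimately have "Poly_Mapping.lookup p t = 0"
      using vanishing_on_grid[where V = V and S = UNIV and T = "Poly_Mapping.keys p"
            and ex = Poly_Mapping.lookup and c = "Poly_Mapping.lookup p", OF fin assms(1) finite_keys
            assms(3) _ _ UNIV_not_empty t]
      by blast
    then show False
      using t by (simp add: in_keys_iff)
  qed
  then show thesis
    using that by blast
qed

text \<open>Multiplication by a nonzero \<open>x\<close> permutes the nonzero elements; comparing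
  their product before and after gives \<open>x ^ (q - 1) = 1\<close>, where \<open>q\<close> is the
  cardinality of the field.\<close>

lemma finite_field_power_card:
  fixes x :: "'k::field"
  assumes "finite (UNIV :: 'k set)"
  shows "x ^ card (UNIV :: 'k set) = x"
proof (cases "x = 0")
  case True
  then show ?thesis
    using assms by (simp add: zero_power finite_UNIV_card_ge_0)
next
  case False
  define U where "U = UNIV - {0 :: 'k}"
  have card: "card (UNIV :: 'k set) = Suc (card U)"
    unfolding U_def using assms by (intro card_Suc_Diff1[symmetric]) auto
  have "bij_betw ((*) x) U U"
    by (rule bij_betwI[where g = "\<lambda>z. z / x"]) (use False in \<open>auto simp: U_def\<close>)
  then have "(\<Prod>z\<in>U. x * z) = (\<Prod>z\<in>U. z)"
    by (rule prod.reindex_bij_betw)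
  then have "x ^ card U * (\<Prod>z\<in>U. z) = 1 * (\<Prod>z\<in>U. z)"
    by (simp add: prod.distrib)
  moreover have "(\<Prod>z\<in>U. z) \<noteq> 0"
    using assms by (simp add: U_def)
  ultimately have "x ^ card U = 1"
    by (metis mult_right_cancel)
  then show ?thesis
    by (simp add: card)
qed

section \<open>Reduction of exponents over a finite field\<close>

lemma reduce_exp_less: "1 < q \<Longrightarrow> reduce_exp q e < q"
proof (induction q e rule: reduce_exp.induct)
  case (1 q e)
  then show ?case
    by (cases "e < q") (simp_all add: reduce_exp.simps[of q e])
qed

lemma reduce_exp_0 [simp]: "reduce_exp q 0 = 0"
  by (subst reduce_exp.simps) auto

lemma power_reduce_exp:
  fixes x :: "'k::comm_monoid_mult"
  assumes "x ^ q = x"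
  shows "x ^ reduce_exp q e = x ^ e"
  using assms
proof (induction q e rule: reduce_exp.induct)
  case (1 q e)
  show ?case
  proof (cases "e < q \<or> q \<le> 1")
    case True
    then show ?thesis
      by (simp add: reduce_exp.simps[of q e])
  next
    case False
    then have "x ^ reduce_exp q e = x ^ (e - (q - 1))"
      using 1 by (simp add: reduce_exp.simps[of q e])
    \<comment> \<open>Since \<open>q \<le> e\<close>, lowering the exponent by \<open>q - 1\<close>
      leaves a factor \<open>x\<close>, which is traded for \<open>x ^ q\<close>.\<close>
    also have "\<dots> = x * x ^ (e - q)"
      using False by (simp add: Suc_diff_le flip: power_Suc)
    also have "\<dots> = x ^ q * x ^ (e - q)"
      using "1.prems" by simp
    also have "\<dots> = x ^ e"
      using False by (simp flip: power_add)
    finally show ?thesis .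
  qed
qed

text \<open>\<open>Poly_Mapping.map\<close> applies the function at nonzero entries only;
  \<open>reduce_exp q 0 = 0\<close> covers the others.\<close>

lemma lookup_map_reduce_exp:
  "Poly_Mapping.lookup (Poly_Mapping.map (reduce_exp q) t) x = reduce_exp q (Poly_Mapping.lookup t x)"
  by (simp add: Poly_Mapping.map.rep_eq when_def)

lemma monom_eval_map_reduce_exp:
  assumes "\<And>x. y x ^ q = y x"
  shows "monom_eval y (Poly_Mapping.map (reduce_exp q) t) = monom_eval y t"
proof -
  have "Poly_Mapping.keys (Poly_Mapping.map (reduce_exp q) t) \<subseteq> Poly_Mapping.keys t"
    by (auto simp: in_keys_iff lookup_map_reduce_exp intro!: gr0I)
  then show ?thesis
    by (subst monom_eval_superset[of "Poly_Mapping.keys t"])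
       (auto simp: lookup_map_reduce_exp power_reduce_exp assms monom_eval_def)
qed

lemma poly_eval_reduce_poly:
  assumes "\<And>x. y x ^ q = y x"
  shows "poly_eval y (reduce_poly q p) = poly_eval y p"
  by (simp add: reduce_poly_def poly_eval_sum monom_eval_map_reduce_exp[OF assms])
     (simp add: poly_eval_def)

lemma keys_reduce_poly:
  assumes "1 < q" "t \<in> Poly_Mapping.keys (reduce_poly q p)"
  shows "Poly_Mapping.lookup t x < q"
proof -
  have "t \<in> (\<Union>u\<in>Poly_Mapping.keys p. Poly_Mapping.keys
      (Poly_Mapping.single (Poly_Mapping.map (reduce_exp q) u) (Poly_Mapping.lookup p u)))"
    using assms(2) unfolding reduce_poly_def by (rule subsetD[OF Poly_Mapping.keys_sum, rotated])
  then obtain u where "t = Poly_Mapping.map (reduce_exp q) u"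
    by (auto split: if_splits)
  then show ?thesis
    using reduce_exp_less[OF assms(1)] by (simp add: lookup_map_reduce_exp)
qed

text \<open>The reduction defines the same function as \<open>p\<close>, and its exponents are below
  the cardinality of the field, so it is zero only if this function is.\<close>

lemma reduce_poly_nonzero_iff:
  fixes p :: "('x, 'k::field) mpoly"
  assumes "finite (UNIV :: 'k set)"
  shows "reduce_poly (card (UNIV :: 'k set)) p \<noteq> 0 \<longleftrightarrow> (\<exists>y. poly_eval y p \<noteq> 0)"
proof -
  let ?q = "card (UNIV :: 'k set)"
  \<comment> \<open>A field has at least two elements, so the guard \<open>q \<le> 1\<close> in
    \<open>reduce_exp\<close> never fires.\<close>
  have "card {0, 1 :: 'k} \<le> ?q"
    using assms by (intro card_mono) auto
  then have q: "1 < ?q"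
    by simp
  have ev: "poly_eval y (reduce_poly ?q p) = poly_eval y p" for y
    by (rule poly_eval_reduce_poly) (rule finite_field_power_card[OF assms])
  show ?thesis
  proof
    assume "reduce_poly ?q p \<noteq> 0"
    then obtain y where "poly_eval y (reduce_poly ?q p) \<noteq> 0"
      by (rule poly_eval_nonzero_finite[OF assms]) (rule keys_reduce_poly[OF q])
    then show "\<exists>y. poly_eval y p \<noteq> 0"
      using ev by metis
  next
    assume "\<exists>y. poly_eval y p \<noteq> 0"
    then show "reduce_poly ?q p \<noteq> 0"
      using ev by (metis poly_eval_0)
  qed
qed

section \<open>Common non-roots over an infinite field\<close>

lemma exists_separating_weight:
  fixes ex :: "'t \<Rightarrow> 'x \<Rightarrow> nat"
  assumes "finite V" "\<And>t x. t \<in> T \<Longrightarrow> x \<in> V \<Longrightarrow> ex t x < N"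
  obtains w :: "'x \<Rightarrow> nat" where
    "\<And>t u. t \<in> T \<Longrightarrow> u \<in> T \<Longrightarrow> (\<Sum>x\<in>V. w x * ex t x) = (\<Sum>x\<in>V. w x * ex u x)
      \<Longrightarrow> \<forall>x\<in>V. ex t x = ex u x"
proof -
  have "\<exists>w. \<forall>t\<in>T. \<forall>u\<in>T. (\<Sum>x\<in>V. w x * ex t x) = (\<Sum>x\<in>V. w x * ex u x)
      \<longrightarrow> (\<forall>x\<in>V. ex t x = ex u x)"
    using assms
  proof (induction V)
    case empty
    then show ?case by simp
  next
    case (insert v V)
    then obtain w where w: "\<And>t u. t \<in> T \<Longrightarrow> u \<in> T \<Longrightarrow>
        (\<Sum>x\<in>V. w x * ex t x) = (\<Sum>x\<in>V. w x * ex u x) \<Longrightarrow> \<forall>x\<in>V. ex t x = ex u x"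
      using insert.IH[OF insert.prems] by blast
    \<comment> \<open>The weights act as powers of \<open>N\<close>: \<open>v\<close> becomes the
      lowest digit and the earlier weights move up by one digit, so exponents below \<open>N\<close>
      can be read off from the weighted sum.\<close>
    define w' where "w' x = (if x = v then 1 else N * w x)" for x
    have sum: "(\<Sum>x\<in>insert v V. w' x * ex t x) = ex t v + N * (\<Sum>x\<in>V. w x * ex t x)" for t
      using insert.hyps
      by (simp add: w'_def sum_distrib_left mult.assoc) (intro sum.cong, auto)
    have "\<forall>x\<in>insert v V. ex t x = ex u x"
      if "t \<in> T" "u \<in> T" "(\<Sum>x\<in>insert v V. w' x * ex t x) = (\<Sum>x\<in>insert v V. w' x * ex u x)" for t u
    proof -
      have lt: "ex t v < N" "ex u v < N"
        using insert.prems that by auto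
      have eq: "ex t v + N * (\<Sum>x\<in>V. w x * ex t x) = ex u v + N * (\<Sum>x\<in>V. w x * ex u x)"
        using that(3) by (simp only: sum)
      have "ex t v = (ex t v + N * (\<Sum>x\<in>V. w x * ex t x)) mod N"
        using lt by simp
      also have "\<dots> = ex u v"
        using lt by (simp add: eq)
      finally have "ex t v = ex u v" .
      moreover from this have "(\<Sum>x\<in>V. w x * ex t x) = (\<Sum>x\<in>V. w x * ex u x)"
        using eq lt by simp
      ultimately show ?thesis
        using w[OF that(1,2)] by blast
    qed
    then show ?case by blast
  qed
  then show thesis
    using that by blast
qed

text \<open>Kronecker substitution \<open>x \<mapsto> z ^ w x\<close> turns all the polynomials into nonzero univariate ones.\<close>

lemma poly_eval_nonzero_infinite:
  fixes p :: "'a \<Rightarrow> ('x, 'k::idom) mpoly"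
  assumes "infinite (UNIV :: 'k set)" "finite J" "\<And>a. a \<in> J \<Longrightarrow> p a \<noteq> 0"
  obtains y where "\<And>a. a \<in> J \<Longrightarrow> poly_eval y (p a) \<noteq> 0"
proof -
  define T where "T = (\<Union>a\<in>J. Poly_Mapping.keys (p a))"
  define V where "V = (\<Union>t\<in>T. Poly_Mapping.keys t)"
  have fin: "finite T" "finite V"
    using assms(2) by (simp_all add: T_def V_def)
  define N where "N = Suc (Max (\<Union>t\<in>T. Poly_Mapping.lookup t ` V))"
  have "Poly_Mapping.lookup t x < N" if "t \<in> T" "x \<in> V" for t x
    unfolding N_def using that fin by (intro le_imp_less_Suc Max_ge) auto
  then obtain w where w: "\<And>t u. t \<in> T \<Longrightarrow> u \<in> T \<Longrightarrow>
      (\<Sum>x\<in>V. w x * Poly_Mapping.lookup t x) = (\<Sum>x\<in>V. w x * Poly_Mapping.lookup u x)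
      \<Longrightarrow> \<forall>x\<in>V. Poly_Mapping.lookup t x = Poly_Mapping.lookup u x"
    using exists_separating_weight[OF fin(2), of T Poly_Mapping.lookup N] by blast
  define W where "W t = (\<Sum>x\<in>V. w x * Poly_Mapping.lookup t x)" for t
  have W: "t = u" if "t \<in> T" "u \<in> T" "W t = W u" for t u
  proof (rule poly_mapping_eqI)
    fix x show "Poly_Mapping.lookup t x = Poly_Mapping.lookup u x"
      using w[of t u] that by (cases "x \<in> V") (auto simp: W_def V_def in_keys_iff)
  qed
  \<comment> \<open>Distinct monomials in \<open>T\<close> have distinct weights, so no coefficients
    merge under the substitution.\<close>
  define f where "f a = (\<Sum>t\<in>Poly_Mapping.keys (p a). Polynomial.monom (Poly_Mapping.lookup (p a) t) (W t))" for a
  have nz: "f a \<noteq> 0" if a: "a \<in> J" for a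
  proof -
    obtain t where t: "t \<in> Poly_Mapping.keys (p a)"
      using assms(3)[OF a] by fastforce
    have "W u = W t \<longleftrightarrow> u = t" if "u \<in> Poly_Mapping.keys (p a)" for u
      using W that t \<open>a \<in> J\<close> by (auto simp: T_def)
    then have "coeff (f a) (W t) = (\<Sum>u\<in>Poly_Mapping.keys (p a). if u = t then Poly_Mapping.lookup (p a) u else 0)"
      unfolding f_def coeff_sum coeff_monom by (intro sum.cong) auto
    also have "\<dots> = Poly_Mapping.lookup (p a) t"
      using t by simp
    finally show ?thesis
      using t by (auto simp: in_keys_iff)
  qed
  \<comment> \<open>One product handles all \<open>a\<close> at once: its finitely many roots miss
    some element of the infinite field.\<close>
  have "(\<Prod>a\<in>J. f a) \<noteq> 0"
    using nz assms(2) by simp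
  then have "finite {z. poly (\<Prod>a\<in>J. f a) z = 0}"
    by (rule poly_roots_finite)
  then obtain z where "poly (\<Prod>a\<in>J. f a) z \<noteq> 0"
    using assms(1) ex_new_if_finite by blast
  then have z: "poly (f a) z \<noteq> 0" if "a \<in> J" for a
    using that assms(2) by (simp add: poly_prod)
  have "monom_eval (\<lambda>x. z ^ w x) t = z ^ W t" if "t \<in> T" for t
    by (subst monom_eval_superset[OF fin(2)])
       (use that in \<open>auto simp: V_def W_def power_sum power_mult\<close>)
  then have "poly_eval (\<lambda>x. z ^ w x) (p a) = poly (f a) z" if "a \<in> J" for a
    unfolding poly_eval_def f_def poly_sum poly_monom
    using that by (intro sum.cong) (auto simp: T_def)
  then show thesis
    using z by (intro that[of "\<lambda>x. z ^ w x"]) simp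
qed

subsection \<open>Families of vectors, exponents and degrees\<close>

lemma sum_fun_apply: "(\<Sum>j\<in>S. F j) x = (\<Sum>j\<in>S. F j x)"
  by (induction S rule: infinite_finite_induct) simp_all

text \<open>Independence of a set ignores repetitions. The hypothesis rules them out: equal members
  at two indices would give a relation with coefficients 1 and -1.\<close>

lemma (in vector_space) independent_family:
  fixes w :: "'i \<Rightarrow> 'b"
  assumes "finite J" "\<And>v. (\<Sum>i\<in>J. v i *s w i) = 0 \<Longrightarrow> \<forall>i\<in>J. v i = 0"
  shows "inj_on w J" "independent (w ` J)"
proof -
  show inj: "inj_on w J"
  proof (rule inj_onI, rule ccontr)
    fix i j assume ij: "i \<in> J" "j \<in> J" "w i = w j" "i \<noteq> j"
    define v :: "'i \<Rightarrow> 'a" where "v k = (if k = i then 1 else if k = j then - 1 else 0)" for k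
    have "(\<Sum>k\<in>J. v k *s w k) = (\<Sum>k\<in>{i, j}. v k *s w k)"
      using assms(1) ij by (intro sum.mono_neutral_right) (auto simp: v_def)
    also have "\<dots> = 0"
      using ij by (simp add: v_def)
    finally have "v i = 0"
      using assms(2) ij by blast
    then show False
      by (simp add: v_def)
  qed
  show "independent (w ` J)"
  proof (rule independent_if_scalars_zero)
    fix f x assume "(\<Sum>x\<in>w ` J. f x *s x) = 0" "x \<in> w ` J"
    then show "f x = 0"
      using assms(2)[of "f \<circ> w"] inj by (auto simp: sum.reindex)
  qed (use assms(1) in auto)
qed

lemma (in vector_space) span_family:
  assumes "finite J" "inj_on w J" "x \<in> span (w ` J)"
  obtains v where "x = (\<Sum>i\<in>J. v i *s w i)"
proof -
  obtain u where "x = (\<Sum>z\<in>w ` J. u z *s z)"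
    using assms(1,3) by (auto simp: span_finite)
  then show thesis
    using assms(2) that[of "u \<circ> w"] by (simp add: sum.reindex)
qed

lemma (in vector_space) representation_lincomb:
  assumes "independent B" "\<And>i. i \<in> J \<Longrightarrow> w i \<in> span B"
  shows "representation B (\<Sum>i\<in>J. v i *s w i) z = (\<Sum>i\<in>J. v i * representation B (w i) z)"
  using assms by (simp add: representation_sum representation_scale span_scale)

lemma internal_direct_sum_finite:
  assumes "finite J"
  shows "internal_direct_sum J N \<longleftrightarrow>
    (\<forall>m. \<exists>!f. (\<forall>j\<in>J. f j \<in> N j) \<and> (\<forall>j. j \<notin> J \<longrightarrow> f j = 0) \<and> (\<Sum>j\<in>J. f j) = m)"
proof -
  have "finite {j. f j \<noteq> 0} \<and> (\<Sum>j | f j \<noteq> 0. f j) = (\<Sum>j\<in>J. f j)"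
    if "\<forall>j. j \<notin> J \<longrightarrow> f j = 0" for f :: "'a \<Rightarrow> 'b"
    using that assms by (auto intro!: sum.mono_neutral_left intro: rev_finite_subset)
  then have "((\<forall>j\<in>J. f j \<in> N j) \<and> (\<forall>j. j \<notin> J \<longrightarrow> f j = 0) \<and>
               finite {j. f j \<noteq> 0} \<and> (\<Sum>j | f j \<noteq> 0. f j) = m)
      \<longleftrightarrow> ((\<forall>j\<in>J. f j \<in> N j) \<and> (\<forall>j. j \<notin> J \<longrightarrow> f j = 0) \<and> (\<Sum>j\<in>J. f j) = m)" for f m
    by (metis (no_types, lifting))
  then show ?thesis
    unfolding internal_direct_sum_def by simp
qed

section \<open>Exponent vectors and components of shifted algebras\<close>

definition mexp :: "('n::finite \<Rightarrow> int) \<Rightarrow> 'n \<Rightarrow>\<^sub>0 nat" where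
  "mexp a = Abs_poly_mapping (\<lambda>k. nat (a k))"

lemma lookup_mexp [simp]: "Poly_Mapping.lookup (mexp a) k = nat (a k)"
  by (simp add: mexp_def)

lemma mdeg_apply [simp]: "mdeg t k = int (Poly_Mapping.lookup t k)"
  by (simp add: mdeg_def)

lemma mexp_mdeg [simp]: "mexp (mdeg t) = t"
  by (rule poly_mapping_eqI) simp

lemma mexp_add: "0 \<le> a \<Longrightarrow> 0 \<le> b \<Longrightarrow> mexp (a + b) = mexp a + mexp b"
  by (rule poly_mapping_eqI) (simp add: lookup_add le_fun_def nat_add_distrib)

lemma X_pow_eq: "X_pow a = Poly_Mapping.single (mexp a) 1"
  by (simp add: X_pow_def mexp_def)

text \<open>The criterion for \<open>X^(a - s)\<close> to be a monomial in the variables of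
  \<open>Z\<close>, so for the shifted algebra to be nonzero in degree \<open>a\<close>; unlike
  \<open>shift_comp\<close> it does not mention the field.\<close>

definition occurs :: "'n set \<Rightarrow> ('n \<Rightarrow> int) \<Rightarrow> ('n \<Rightarrow> int) \<Rightarrow> bool" where
  "occurs Z s a \<longleftrightarrow> s \<le> a \<and> (\<forall>k. s k \<noteq> a k \<longrightarrow> k \<in> Z)"

lemma occurs_iff:
  fixes s a :: "'n::finite \<Rightarrow> int"
  shows "occurs Z s a \<longleftrightarrow> (\<exists>t. Poly_Mapping.keys t \<subseteq> Z \<and> a = s + mdeg t)"
proof
  assume "occurs Z s a"
  then have "Poly_Mapping.keys (mexp (a - s)) \<subseteq> Z \<and> a = s + mdeg (mexp (a - s))"
    by (auto simp: occurs_def in_keys_iff le_fun_def fun_eq_iff)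
  then show "\<exists>t. Poly_Mapping.keys t \<subseteq> Z \<and> a = s + mdeg t" ..
next
  assume "\<exists>t. Poly_Mapping.keys t \<subseteq> Z \<and> a = s + mdeg t"
  then show "occurs Z s a"
    by (auto simp: occurs_def in_keys_iff le_fun_def)
qed

lemma occurs_mdeg: "occurs Z s a \<Longrightarrow> s + mdeg (mexp (a - s)) = a"
  by (auto simp: occurs_def le_fun_def fun_eq_iff)

lemma occurs_keys: "occurs Z s a \<Longrightarrow> Poly_Mapping.keys (mexp (a - s)) \<subseteq> Z"
  by (auto simp: occurs_def le_fun_def in_keys_iff)

text \<open>The difference \<open>a - s\<close> determines the only monomial that can occur, so each
  component of the shifted algebra is at most one-dimensional.\<close>

lemma shift_comp_eq:
  "shift_comp Z s a = (if occurs Z s a then range (Poly_Mapping.single (mexp (a - s))) else {0})"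
proof (intro Set.set_eqI iffI)
  fix p :: "('a, 'b) mpoly" assume p: "p \<in> shift_comp Z s a"
  show "p \<in> (if occurs Z s a then range (Poly_Mapping.single (mexp (a - s))) else {0})"
  proof (cases "p = 0")
    case True
    then show ?thesis
      by (auto intro: range_eqI[of _ _ 0])
  next
    case False
    have t: "t = mexp (a - s)" "a = s + mdeg t" "Poly_Mapping.keys t \<subseteq> Z"
      if "t \<in> Poly_Mapping.keys p" for t
    proof -
      have *: "mdeg t = a - s"
        using p that by (simp add: shift_comp_def)
      show "t = mexp (a - s)"
        unfolding *[symmetric] by simp
      show "a = s + mdeg t"
        unfolding * by simp
    qed (use p that in \<open>auto simp: shift_comp_def subalg_def\<close>)
    obtain u where u: "u \<in> Poly_Mapping.keys p"
      using False by fastforce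
    have "occurs Z s a"
      unfolding occurs_iff by (intro exI[of _ u] conjI t(2,3)[OF u])
    moreover have "p = Poly_Mapping.single (mexp (a - s)) (Poly_Mapping.lookup p (mexp (a - s)))"
    proof (rule poly_mapping_eqI)
      fix u
      show "Poly_Mapping.lookup p u =
          Poly_Mapping.lookup (Poly_Mapping.single (mexp (a - s)) (Poly_Mapping.lookup p (mexp (a - s)))) u"
        using t(1)[of u] by (cases "u = mexp (a - s)") (auto simp: lookup_single_not_eq in_keys_iff)
    qed
    ultimately show ?thesis
      by (auto intro: range_eqI)
  qed
next
  fix p :: "('a, 'b) mpoly"
  assume "p \<in> (if occurs Z s a then range (Poly_Mapping.single (mexp (a - s))) else {0})"
  then show "p \<in> shift_comp Z s a"
  proof (cases "occurs Z s a")
    case True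
    have "mdeg (mexp (a - s)) = a - s"
      using occurs_mdeg[OF True] by (metis add_diff_cancel_left')
    then show ?thesis
      using \<open>p \<in> _\<close> True occurs_keys[OF True] by (auto simp: shift_comp_def subalg_def split: if_splits)
  qed (simp add: shift_comp_def subalg_def)
qed

lemma occurring_eq: "occurring TYPE('k::field) I Z s a = {i\<in>I. occurs (Z i) (s i) (a :: 'n::finite \<Rightarrow> int)}"
proof -
  have "range (Poly_Mapping.single t) \<noteq> {0 :: ('n, 'k) mpoly}" for t
    by (metis rangeI singletonD lookup_single_eq lookup_zero zero_neq_one)
  then show ?thesis
    by (auto simp: occurring_def shift_comp_eq)
qed

lemma subalg_0 [simp]: "0 \<in> subalg Z"
  by (simp add: subalg_def)

lemma subalg_single: "Poly_Mapping.keys t \<subseteq> Z \<Longrightarrow> Poly_Mapping.single t c \<in> subalg Z"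
  by (simp add: subalg_def)

lemma subalg_sum: "(\<And>j. j \<in> S \<Longrightarrow> f j \<in> subalg Z) \<Longrightarrow> (\<Sum>j\<in>S. f j) \<in> subalg Z"
  using Poly_Mapping.keys_sum[of f S] by (fastforce simp: subalg_def)

lemma subalg_diff:
  fixes p q :: "('n, 'k::field) mpoly"
  shows "p \<in> subalg Z \<Longrightarrow> q \<in> subalg Z \<Longrightarrow> p - q \<in> subalg Z"
  using Poly_Mapping.keys_diff[of p q] by (fastforce simp: subalg_def)

lemma const_mult_single: "const c * Poly_Mapping.single t d = Poly_Mapping.single t (c * d)"
  by (simp add: const_def mult_single)

subsection \<open>Graded modules\<close>

context graded_module
begin

sublocale K: vector_space "kscale scale"
  by unfold_locales
     (simp_all add: kscale_def scale_right_distrib const_def single_add mult_single flip: scale_left_distrib)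

lemma kscale_single:
  "kscale scale c (scale (Poly_Mapping.single t d) m) = scale (Poly_Mapping.single t (c * d)) m"
  by (simp add: kscale_def const_mult_single)

lemma scale_kscale: "scale p (kscale scale c m) = kscale scale c (scale p m)"
  by (simp add: kscale_def mult.commute)

lemma linear_scale: "Vector_Spaces.linear (kscale scale) (kscale scale) (scale p)"
  by unfold_locales (simp_all add: scale_right_distrib scale_kscale)

lemma gr_K_subspace: "K.subspace (gr a)"
  by (rule gr_subspace)

lemma gr_zero [simp]: "0 \<in> gr a"
  using gr_K_subspace by (rule K.subspace_0)

lemma gr_sum_eq_0:
  assumes "finite A" "\<And>a. a \<in> A \<Longrightarrow> f a \<in> gr a" "(\<Sum>a\<in>A. f a) = 0" "a \<in> A"
  shows "f a = 0"
proof -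
  \<comment> \<open>\<open>h\<close> extends \<open>f\<close> by 0, so that uniqueness of the
    homogeneous decomposition of 0 applies to it.\<close>
  define h where "h a = (if a \<in> A then f a else 0)" for a
  have "finite {a. h a \<noteq> 0}"
    by (rule finite_subset[OF _ assms(1)]) (auto simp: h_def)
  moreover have "(\<Sum>a | h a \<noteq> 0. h a) = (\<Sum>a\<in>A. f a)"
    by (rule sum.mono_neutral_cong_left) (use assms in \<open>auto simp: h_def\<close>)
  ultimately have "(\<forall>a\<in>UNIV. h a \<in> gr a) \<and> (\<forall>a. a \<notin> UNIV \<longrightarrow> h a = 0) \<and>
      finite {a. h a \<noteq> 0} \<and> (\<Sum>a | h a \<noteq> 0. h a) = 0"
    using assms by (auto simp: h_def)
  moreover have "(\<forall>a\<in>UNIV. 0 a \<in> gr a) \<and> (\<forall>a. a \<notin> UNIV \<longrightarrow> 0 a = (0 :: 'm)) \<and>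
      finite {a :: 'n \<Rightarrow> int. 0 a \<noteq> (0 :: 'm)} \<and> (\<Sum>a :: 'n \<Rightarrow> int | 0 a \<noteq> (0 :: 'm). 0 a) = (0 :: 'm)"
    by simp
  ultimately have "h = 0"
    using gr_direct_sum unfolding internal_direct_sum_def by blast
  then show ?thesis
    using assms(4) by (metis h_def zero_fun_apply)
qed

lemma gr_decomp:
  obtains A f where "finite A" "\<And>a. f a \<in> gr a" "m = (\<Sum>a\<in>A. f a)"
proof -
  obtain f where "\<forall>a. f a \<in> gr a" "finite {a. f a \<noteq> 0}" "(\<Sum>a | f a \<noteq> 0. f a) = m"
    using gr_direct_sum unfolding internal_direct_sum_def by (metis UNIV_I)
  then show thesis
    using that by metis
qed

text \<open>Induction on the total degree of \<open>t\<close>, multiplying by one variable at a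
  time: the degrees reached only grow, so each further variable \<open>k\<close> still acts
  bijectively.\<close>

lemma bij_scale_monomial:
  assumes "positively_determined scale gr g" "\<And>k. k \<in> Poly_Mapping.keys t \<Longrightarrow> g k \<le> a k"
  shows "bij_betw (scale (Poly_Mapping.single t 1)) (gr a) (gr (a + mdeg t))"
  using assms(2)
proof (induction "\<Sum>k\<in>UNIV. Poly_Mapping.lookup t k" arbitrary: t)
  case 0
  then have "t = 0"
    by (intro poly_mapping_eqI) auto
  moreover have "mdeg (0 :: 'n \<Rightarrow>\<^sub>0 nat) = 0"
    by (simp add: fun_eq_iff)
  ultimately show ?case
    by (simp add: bij_betw_def inj_on_def)
next
  case (Suc n)
  have "(\<Sum>k\<in>UNIV. Poly_Mapping.lookup t k) \<noteq> 0"
    unfolding Suc.hyps(2)[symmetric] by simp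
  then obtain k where "Poly_Mapping.lookup t k \<noteq> 0"
    by (rule sum.not_neutral_contains_not_neutral)
  then have k: "Poly_Mapping.lookup t k > 0"
    by simp
  define u where "u = t - Poly_Mapping.single k 1"
  have t: "t = u + Poly_Mapping.single k 1"
    by (rule poly_mapping_eqI) (use k in \<open>auto simp: u_def lookup_add lookup_minus lookup_single when_def\<close>)
  have "(\<Sum>j\<in>UNIV. Poly_Mapping.lookup t j) = (\<Sum>j\<in>UNIV. Poly_Mapping.lookup u j) + 1"
    by (simp add: t lookup_add sum.distrib lookup_single when_def)
  then have "n = (\<Sum>j\<in>UNIV. Poly_Mapping.lookup u j)"
    using Suc.hyps(2) by simp
  moreover have "g j \<le> a j" if "j \<in> Poly_Mapping.keys u" for j
    using that by (intro Suc.prems) (simp add: t in_keys_iff lookup_add)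
  ultimately have u: "bij_betw (scale (Poly_Mapping.single u 1)) (gr a) (gr (a + mdeg u))"
    by (rule Suc.hyps(1))
  have "g k \<le> a k"
    using k by (intro Suc.prems) (simp add: in_keys_iff)
  then have "g k \<le> (a + mdeg u) k"
    by simp
  then have "bij_betw (scale (var k)) (gr (a + mdeg u)) (gr (a + mdeg u + unit_vec k))"
    using assms(1) unfolding positively_determined_def by blast
  moreover have "a + mdeg u + unit_vec k = a + mdeg t"
    by (auto simp: fun_eq_iff t lookup_add unit_vec_def lookup_single when_def)
  moreover have "scale (var k) \<circ> scale (Poly_Mapping.single u 1) = scale (Poly_Mapping.single t 1)"
    by (auto simp: fun_eq_iff var_def mult_single t add.commute)
  ultimately show ?case
    using bij_betw_trans[OF u] by metis
qed

end

subsection \<open>Hilbert decompositions\<close>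

locale hilbert_decomposed = graded_module scale gr
  for scale :: "('n::finite, 'k::field) mpoly \<Rightarrow> 'm::ab_group_add \<Rightarrow> 'm" and gr +
  fixes I :: "'i set" and Z :: "'i \<Rightarrow> 'n set" and s :: "'i \<Rightarrow> 'n \<Rightarrow> int"
  assumes hilbert: "hilbert_decomposition scale gr I Z s"
begin

definition C :: "('n \<Rightarrow> int) \<Rightarrow> 'i set" where
  "C a = {i\<in>I. occurs (Z i) (s i) a}"

definition term_at :: "('i \<Rightarrow> 'm) \<Rightarrow> ('n \<Rightarrow> int) \<Rightarrow> 'i \<Rightarrow> 'm" where
  "term_at m a i = scale (X_pow (a - s i)) (m i)"

text \<open>Stated for families: a vector repeated for two indices counts as a dependence, as two
  equal columns do in a determinant.\<close>

definition indep_at :: "('i \<Rightarrow> 'm) \<Rightarrow> ('n \<Rightarrow> int) \<Rightarrow> bool" where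
  "indep_at m a \<longleftrightarrow> (\<forall>v. (\<Sum>i\<in>C a. kscale scale (v i) (term_at m a i)) = 0 \<longrightarrow> (\<forall>i\<in>C a. v i = 0))"

lemma finite_I [simp]: "finite I"
  using hilbert by (simp add: hilbert_decomposition_def)

lemma finite_C [simp]: "finite (C a)"
  by (simp add: C_def)

lemma kscale_term_at:
  "kscale scale c (term_at m a i) = scale (Poly_Mapping.single (mexp (a - s i)) c) (m i)"
  by (simp add: term_at_def X_pow_eq kscale_single)

lemma term_at_gr:
  assumes "i \<in> C a" "m i \<in> gr (s i)"
  shows "term_at m a i \<in> gr a"
  using gr_scale[OF assms(2), of "mexp (a - s i)" 1] assms(1) occurs_mdeg[of "Z i" "s i" a]
  by (simp add: term_at_def X_pow_eq C_def)

text \<open>The Hilbert decomposition identifies \<open>gr a\<close> with a sum of one-dimensional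
  spaces, one for each \<open>i\<close> in \<open>C a\<close>; the preimages of the monomials
  \<open>X^(a - s i)\<close> form the basis.\<close>

lemma gr_basis:
  obtains \<beta> where "inj_on \<beta> (C a)" "K.independent (\<beta> ` C a)" "K.span (\<beta> ` C a) = gr a"
proof -
  obtain \<phi> :: "'m \<Rightarrow> 'i \<Rightarrow> ('n, 'k) mpoly" where
    lin: "Vector_Spaces.linear (kscale scale) (\<lambda>c f i. const c * f i) \<phi>" and
    bij: "bij_betw \<phi> UNIV {f. (\<forall>i\<in>I. f i \<in> subalg (Z i)) \<and> (\<forall>i. i \<notin> I \<longrightarrow> f i = 0)}" and
    img: "\<phi> ` gr a = {f. (\<forall>i\<in>I. f i \<in> shift_comp (Z i) (s i) a) \<and> (\<forall>i. i \<notin> I \<longrightarrow> f i = 0)}"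
    using hilbert unfolding hilbert_decomposition_def by blast
  interpret \<phi>: Vector_Spaces.linear "kscale scale" "\<lambda>c f i. const c * f i" \<phi>
    by (rule lin)
  have inj: "inj \<phi>"
    using bij by (simp add: bij_betw_def)
  define e where "e i = (\<lambda>j. if j = i then Poly_Mapping.single (mexp (a - s i)) (1 :: 'k) else 0)" for i
  have "\<exists>x. x \<in> gr a \<and> \<phi> x = e i" if "i \<in> C a" for i
  proof -
    have "e i \<in> \<phi> ` gr a"
      unfolding img using that by (auto simp: e_def C_def shift_comp_eq intro: range_eqI[of _ _ 0])
    then show ?thesis by auto
  qed
  then obtain \<beta> where \<beta>: "\<beta> i \<in> gr a" "\<phi> (\<beta> i) = e i" if "i \<in> C a" for i
    by metis
  \<comment> \<open>The isomorphism turns a linear combination of the \<open>\<beta> i\<close> into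
    the tuple of monomials with the same coefficients, which gives both independence and
    spanning.\<close>
  have eval: "\<phi> (\<Sum>i\<in>C a. kscale scale (v i) (\<beta> i))
      = (\<lambda>j. if j \<in> C a then Poly_Mapping.single (mexp (a - s j)) (v j) else 0)" for v
  proof -
    have "\<phi> (\<Sum>i\<in>C a. kscale scale (v i) (\<beta> i)) j = (\<Sum>i\<in>C a. const (v i) * e i j)" for j
      by (simp add: \<phi>.sum \<phi>.scale sum_fun_apply \<beta>)
    also have "\<dots> j = (\<Sum>i\<in>C a. if j = i then Poly_Mapping.single (mexp (a - s j)) (v j) else 0)" for j
      by (intro sum.cong) (auto simp: e_def const_mult_single)
    finally show ?thesis
      by (auto simp: fun_eq_iff)
  qed
  have "\<forall>i\<in>C a. v i = 0" if "(\<Sum>i\<in>C a. kscale scale (v i) (\<beta> i)) = 0" for v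
  proof
    fix i assume i: "i \<in> C a"
    have "\<phi> 0 i = Poly_Mapping.single (mexp (a - s i)) (v i)"
      using fun_cong[OF eval[of v], of i] i unfolding that by simp
    then have "0 = Poly_Mapping.single (mexp (a - s i)) (v i)"
      by simp
    then show "v i = 0"
      by (metis lookup_single_eq lookup_zero)
  qed
  note ind = K.independent_family[OF finite_C this]
  have "K.span (\<beta> ` C a) = gr a"
  proof (rule K.span_subspace)
    show "\<beta> ` C a \<subseteq> gr a"
      using \<beta> by auto
    show "gr a \<subseteq> K.span (\<beta> ` C a)"
    proof
      fix x assume "x \<in> gr a"
      then have "\<phi> x \<in> \<phi> ` gr a"
        by simp
      then have x: "\<And>i. i \<in> I \<Longrightarrow> \<phi> x i \<in> shift_comp (Z i) (s i) a" "\<And>i. i \<notin> I \<Longrightarrow> \<phi> x i = 0"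
        unfolding img by auto
      have "\<phi> x j = (if j \<in> C a then Poly_Mapping.single (mexp (a - s j))
          (Poly_Mapping.lookup (\<phi> x j) (mexp (a - s j))) else 0)" for j
        using x[of j] by (cases "j \<in> I") (auto simp: C_def shift_comp_eq split: if_splits)
      then have "\<phi> x = \<phi> (\<Sum>i\<in>C a. kscale scale (Poly_Mapping.lookup (\<phi> x i) (mexp (a - s i))) (\<beta> i))"
        unfolding eval by (auto simp: fun_eq_iff)
      then have "x = (\<Sum>i\<in>C a. kscale scale (Poly_Mapping.lookup (\<phi> x i) (mexp (a - s i))) (\<beta> i))"
        using inj by (simp add: inj_def)
      also have "\<dots> \<in> K.span (\<beta> ` C a)"
        by (intro K.span_sum K.span_scale K.span_base) auto
      finally show "x \<in> K.span (\<beta> ` C a)" .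
    qed
  qed (rule gr_K_subspace)
  with ind show thesis
    using that by blast
qed

lemma dim_gr: "K.dim (gr a) = card (C a)"
  by (metis gr_basis K.dim_span_eq_card_independent card_image)

text \<open>A basis of the zero space is empty, and the basis of \<open>gr a\<close> has
  \<open>C a\<close> as its index set.\<close>

lemma gr_eq_0_imp_C_empty: "gr a = {0} \<Longrightarrow> C a = {}"
proof -
  assume "gr a = {0}"
  moreover obtain \<beta> where \<beta>: "K.independent (\<beta> ` C a)" "K.span (\<beta> ` C a) = gr a"
    by (rule gr_basis)
  ultimately have "\<beta> ` C a \<subseteq> {0}"
    using K.span_superset[of "\<beta> ` C a"] by simp
  moreover have "0 \<notin> \<beta> ` C a"
    using \<beta>(1) K.dependent_zero[of "\<beta> ` C a"] by auto
  ultimately have "\<beta> ` C a = {}"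
    by (metis subset_singletonD insertI1)
  then show "C a = {}"
    by auto
qed

section \<open>Stanley decompositions as independence in every degree\<close>

lemma indep_at_spanning:
  assumes "\<And>i. i \<in> I \<Longrightarrow> m i \<in> gr (s i)" "indep_at m a" "x \<in> gr a"
  obtains v where "x = (\<Sum>i\<in>C a. kscale scale (v i) (term_at m a i))"
proof -
  let ?w = "term_at m a"
  have ind: "inj_on ?w (C a)" "K.independent (?w ` C a)"
    using assms(2) unfolding indep_at_def by (intro K.independent_family; simp)+
  obtain \<beta> where \<beta>: "inj_on \<beta> (C a)" "K.independent (\<beta> ` C a)" "K.span (\<beta> ` C a) = gr a"
    by (rule gr_basis)
  \<comment> \<open>A vector outside the span would extend the terms to an independent set of more
    than \<open>card (C a)\<close> vectors in a space of that dimension.\<close>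
  have "x \<in> K.span (?w ` C a)"
  proof (rule ccontr)
    assume x: "x \<notin> K.span (?w ` C a)"
    then have "K.independent (insert x (?w ` C a))"
      using ind(2) by (rule K.independent_insertI)
    moreover have "insert x (?w ` C a) \<subseteq> K.span (\<beta> ` C a)"
      unfolding \<beta>(3) using assms(1,3) term_at_gr by (auto simp: C_def)
    ultimately have "card (insert x (?w ` C a)) \<le> card (\<beta> ` C a)"
      using K.independent_span_bound[of "\<beta> ` C a"] by simp
    moreover have "x \<notin> ?w ` C a"
      using x K.span_base by blast
    ultimately show False
      using ind(1) \<beta>(1) by (simp add: card_image)
  qed
  then show thesis
    using K.span_family[OF finite_C ind(1)] that by blast
qed

text \<open>The relation is split into its homogeneous components: in degree \<open>a\<close> it
  involves only the coefficient of \<open>X^(a - s i)\<close> in each \<open>p i\<close>, and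
  \<open>indep_at m a\<close> makes these vanish.\<close>

lemma subalg_relation_imp_0:
  assumes m: "\<And>i. i \<in> I \<Longrightarrow> m i \<in> gr (s i)" and ind: "\<And>a. indep_at m a"
    and p: "\<And>i. i \<in> I \<Longrightarrow> p i \<in> subalg (Z i)"
    and rel: "(\<Sum>i\<in>I. scale (p i) (m i)) = 0" and i: "i \<in> I"
  shows "p i = 0"
proof -
  define A where "A = (\<Union>i\<in>I. (\<lambda>t. s i + mdeg t) ` Poly_Mapping.keys (p i))"
  define v where "v a i = Poly_Mapping.lookup (p i) (mexp (a - s i))" for a i
  define f where "f a = (\<Sum>i\<in>C a. kscale scale (v a i) (term_at m a i))" for a
  have fin: "finite A"
    by (simp add: A_def)
  have p_eq: "p i = (\<Sum>a\<in>A. if i \<in> C a then Poly_Mapping.single (mexp (a - s i)) (v a i) else 0)"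
    if i: "i \<in> I" for i
  proof (rule poly_mapping_eqI)
    fix t
    have "Poly_Mapping.lookup (\<Sum>a\<in>A. if i \<in> C a then Poly_Mapping.single (mexp (a - s i)) (v a i) else 0) t
        = (\<Sum>a\<in>A. if a = s i + mdeg t then Poly_Mapping.lookup (p i) t else 0)"
      unfolding lookup_sum
    proof (rule sum.cong)
      fix a assume "a \<in> A"
      show "Poly_Mapping.lookup (if i \<in> C a then Poly_Mapping.single (mexp (a - s i)) (v a i) else 0) t
          = (if a = s i + mdeg t then Poly_Mapping.lookup (p i) t else 0)"
      proof (cases "a = s i + mdeg t")
        case True
        show ?thesis
        proof (cases "t \<in> Poly_Mapping.keys (p i)")
          case t: True
          then have "Poly_Mapping.keys t \<subseteq> Z i"
            using p[OF i] by (auto simp: subalg_def)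
          then have "i \<in> C a"
            using i True by (auto simp: C_def occurs_iff)
          then show ?thesis
            using True by (simp add: v_def)
        qed (auto simp: True v_def in_keys_iff)
      next
        case False
        \<comment> \<open>\<open>mexp\<close> cuts negative entries off at 0, so
          \<open>mexp (a - s i)\<close> determines \<open>a\<close> only for \<open>i\<close> in
          \<open>C a\<close>.\<close>
        then have "mexp (a - s i) \<noteq> t" if "i \<in> C a"
          using that occurs_mdeg[of "Z i" "s i" a] by (auto simp: C_def)
        then show ?thesis
          using False by (simp add: lookup_single_not_eq)
      qed
    qed simp
    also have "\<dots> = Poly_Mapping.lookup (p i) t"
    proof (cases "t \<in> Poly_Mapping.keys (p i)")
      case True
      then have "s i + mdeg t \<in> A"
        using i by (auto simp: A_def)
      then show ?thesis
        using fin by simp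
    qed (simp add: in_keys_iff cong: if_cong)
    finally show "Poly_Mapping.lookup (p i) t =
        Poly_Mapping.lookup (\<Sum>a\<in>A. if i \<in> C a then Poly_Mapping.single (mexp (a - s i)) (v a i) else 0) t" ..
  qed
  have C_I: "{i \<in> I. i \<in> C a} = C a" for a
    by (auto simp: C_def)
  have "(\<Sum>a\<in>A. f a) = (\<Sum>a\<in>A. \<Sum>i\<in>I. if i \<in> C a then kscale scale (v a i) (term_at m a i) else 0)"
    by (simp add: f_def sum.If_cases C_I Int_def)
  also have "\<dots> = (\<Sum>i\<in>I. \<Sum>a\<in>A. if i \<in> C a then kscale scale (v a i) (term_at m a i) else 0)"
    by (rule sum.swap)
  also have "\<dots> = (\<Sum>i\<in>I. scale (p i) (m i))"
  proof (rule sum.cong)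
    fix i assume "i \<in> I"
    show "(\<Sum>a\<in>A. if i \<in> C a then kscale scale (v a i) (term_at m a i) else 0) = scale (p i) (m i)"
      by (subst p_eq[OF \<open>i \<in> I\<close>], subst scale_sum_left) (auto simp: kscale_term_at intro!: sum.cong)
  qed simp
  also note rel
  finally have "f a = 0" if "a \<in> A" for a
    using that fin
    by (intro gr_sum_eq_0[of A f])
       (auto simp: f_def C_def intro!: K.subspace_sum[OF gr_K_subspace] K.subspace_scale[OF gr_K_subspace] term_at_gr m)
  then have "v a i = 0" if "a \<in> A" "i \<in> C a" for a i
    using that ind[of a] unfolding indep_at_def f_def by blast
  then show ?thesis
    by (subst p_eq[OF i]) (auto intro!: sum.neutral)
qed

text \<open>From left to right, a relation in degree \<open>a\<close> is a representation of 0 in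
  the direct sum, so its summands vanish, and the annihilator condition makes the coefficients
  vanish. Conversely, the dimension count turns independence into spanning, which gives
  representations degree by degree; their uniqueness is
  \<open>subalg_relation_imp_0\<close>.\<close>

lemma stanley_decomposition_iff:
  assumes m: "\<And>i. i \<in> I \<Longrightarrow> m i \<in> gr (s i)"
  shows "stanley_decomposition scale gr I Z m \<longleftrightarrow> (\<forall>a. indep_at m a)"
proof
  assume S: "stanley_decomposition scale gr I Z m"
  show "\<forall>a. indep_at m a"
    unfolding indep_at_def
  proof (intro allI impI ballI)
    fix a v i assume v: "(\<Sum>i\<in>C a. kscale scale (v i) (term_at m a i)) = 0" and i: "i \<in> C a"
    define p where "p i = (if i \<in> C a then Poly_Mapping.single (mexp (a - s i)) (v i) else 0)" for i
    have p: "p i \<in> subalg (Z i)" for i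
      by (auto simp: p_def C_def intro!: subalg_single dest: occurs_keys)
    define f where "f i = scale (p i) (m i)" for i
    have "(\<Sum>i\<in>I. f i) = (\<Sum>i\<in>C a. f i)"
      by (rule sum.mono_neutral_right) (auto simp: C_def f_def p_def)
    also have "\<dots> = 0"
      unfolding v[symmetric] by (rule sum.cong) (auto simp: f_def p_def kscale_term_at)
    finally have f: "(\<forall>i\<in>I. f i \<in> (\<lambda>p. scale p (m i)) ` subalg (Z i)) \<and> (\<forall>i. i \<notin> I \<longrightarrow> f i = 0) \<and> (\<Sum>i\<in>I. f i) = 0"
      using p by (auto simp: f_def) (auto simp: p_def C_def)
    have zero: "(\<forall>i\<in>I. (\<lambda>_. 0) i \<in> (\<lambda>p. scale p (m i)) ` subalg (Z i)) \<and> (\<forall>i. i \<notin> I \<longrightarrow> (\<lambda>_. 0) i = (0::'m))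
        \<and> (\<Sum>i\<in>I. (\<lambda>_. 0) i) = (0::'m)"
      by (auto intro!: image_eqI[of _ _ 0])
    have ex1: "\<exists>!f. (\<forall>i\<in>I. f i \<in> (\<lambda>p. scale p (m i)) ` subalg (Z i)) \<and> (\<forall>i. i \<notin> I \<longrightarrow> f i = 0) \<and> (\<Sum>i\<in>I. f i) = 0"
      using S unfolding stanley_decomposition_def internal_direct_sum_finite[OF finite_I] by simp
    have "f = (\<lambda>_. 0)"
      using the1_equality[OF ex1, of f, OF f] the1_equality[OF ex1, of "\<lambda>_. 0", OF zero] by simp
    then have "scale (p i) (m i) = 0"
      by (metis f_def)
    moreover have "subalg (Z i) \<inter> {p. scale p (m i) = 0} = {0}"
      using S i by (simp add: stanley_decomposition_def C_def)
    ultimately have "p i = 0"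
      using p by blast
    then show "v i = 0"
      using i by (metis p_def lookup_single_eq lookup_zero)
  qed
next
  assume ind: "\<forall>a. indep_at m a"
  show "stanley_decomposition scale gr I Z m"
    unfolding stanley_decomposition_def internal_direct_sum_finite[OF finite_I]
  proof (intro conjI ballI allI)
    fix i assume i: "i \<in> I"
    show "\<exists>a. m i \<in> gr a"
      using m[OF i] by blast
    have "p = 0" if p: "p \<in> subalg (Z i)" "scale p (m i) = 0" for p
    proof -
      \<comment> \<open>The annihilator condition at \<open>i\<close> is the case of a relation with
        at most one nonzero entry.\<close>
      have "(if i = i then p else 0) = 0"
        by (rule subalg_relation_imp_0[of m "\<lambda>j. if j = i then p else 0"])
           (use m ind p i in \<open>auto intro!: sum.neutral\<close>)
      then show ?thesis by simp
    qed
    then show "subalg (Z i) \<inter> {p. scale p (m i) = 0} = {0}"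
      by auto
  next
    fix x
    show "\<exists>!f. (\<forall>i\<in>I. f i \<in> (\<lambda>p. scale p (m i)) ` subalg (Z i)) \<and> (\<forall>i. i \<notin> I \<longrightarrow> f i = 0) \<and> (\<Sum>i\<in>I. f i) = x"
    proof (rule ex_ex1I)
      obtain A f where A: "finite A" "\<And>a. f a \<in> gr a" "x = (\<Sum>a\<in>A. f a)"
        using gr_decomp[of x] by blast
      have "\<exists>v. f a = (\<Sum>i\<in>C a. kscale scale (v i) (term_at m a i))" for a
        using indep_at_spanning[of m a "f a"] m ind A(2) by metis
      then obtain v where v: "f a = (\<Sum>i\<in>C a. kscale scale (v a i) (term_at m a i))" for a
        by metis
      define p where "p a i = (if i \<in> C a then Poly_Mapping.single (mexp (a - s i)) (v a i) else 0)" for a i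
      have "f a = (\<Sum>i\<in>I. scale (p a i) (m i))" for a
        unfolding v by (rule sum.mono_neutral_cong_left) (auto simp: C_def p_def kscale_term_at)
      then have "x = (\<Sum>i\<in>I. scale (\<Sum>a\<in>A. p a i) (m i))"
        unfolding A(3) scale_sum_left by (simp add: sum.swap[of _ I A])
      moreover have "(\<Sum>a\<in>A. p a i) \<in> subalg (Z i)" for i
        by (intro subalg_sum) (auto simp: p_def C_def intro!: subalg_single dest: occurs_keys)
      ultimately show "\<exists>f. (\<forall>i\<in>I. f i \<in> (\<lambda>p. scale p (m i)) ` subalg (Z i)) \<and> (\<forall>i. i \<notin> I \<longrightarrow> f i = 0) \<and> (\<Sum>i\<in>I. f i) = x"
        by (intro exI[of _ "\<lambda>i. if i \<in> I then scale (\<Sum>a\<in>A. p a i) (m i) else 0"]) auto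
    next
      fix f h
      assume f: "(\<forall>i\<in>I. f i \<in> (\<lambda>p. scale p (m i)) ` subalg (Z i)) \<and> (\<forall>i. i \<notin> I \<longrightarrow> f i = 0) \<and> (\<Sum>i\<in>I. f i) = x"
        and h: "(\<forall>i\<in>I. h i \<in> (\<lambda>p. scale p (m i)) ` subalg (Z i)) \<and> (\<forall>i. i \<notin> I \<longrightarrow> h i = 0) \<and> (\<Sum>i\<in>I. h i) = x"
      have "\<forall>i\<in>I. \<exists>p. p \<in> subalg (Z i) \<and> f i = scale p (m i)"
        using f by blast
      from bchoice[OF this]
      obtain p where p: "\<And>i. i \<in> I \<Longrightarrow> p i \<in> subalg (Z i)" "\<And>i. i \<in> I \<Longrightarrow> f i = scale (p i) (m i)"
        by blast
      have "\<forall>i\<in>I. \<exists>p. p \<in> subalg (Z i) \<and> h i = scale p (m i)"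
        using h by blast
      from bchoice[OF this]
      obtain r where r: "\<And>i. i \<in> I \<Longrightarrow> r i \<in> subalg (Z i)" "\<And>i. i \<in> I \<Longrightarrow> h i = scale (r i) (m i)"
        by blast
      have "(\<Sum>i\<in>I. scale (p i - r i) (m i)) = (\<Sum>i\<in>I. f i) - (\<Sum>i\<in>I. h i)"
        by (simp add: p r scale_left_diff_distrib sum_subtractf)
      then have "(\<Sum>i\<in>I. scale (p i - r i) (m i)) = 0"
        using f h by simp
      moreover have "p i - r i \<in> subalg (Z i)" if "i \<in> I" for i
        using p(1)[OF that] r(1)[OF that] by (rule subalg_diff)
      ultimately have "p i - r i = 0" if "i \<in> I" for i
        using that m ind by (intro subalg_relation_imp_0[of m "\<lambda>i. p i - r i"]) auto
      then have "f i = h i" for i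
        using f h p r by (cases "i \<in> I") auto
      then show "f = h" ..
    qed
  qed simp
qed

end

text \<open>A square matrix over a field is singular iff it has a nonzero kernel vector. Kernel
  vectors are given as plain functions on the column numbers, to match the coefficient families in
  \<open>indep_at\<close>.\<close>

lemma det_nonzero_iff_columns_independent:
  fixes M :: "'a::field mat"
  assumes "M \<in> carrier_mat n n"
  shows "det M \<noteq> 0 \<longleftrightarrow> (\<forall>v. (\<forall>k<n. (\<Sum>c<n. M $$ (k, c) * v c) = 0) \<longrightarrow> (\<forall>c<n. v c = 0))"
proof -
  have mult: "M *\<^sub>v vec n v = 0\<^sub>v n \<longleftrightarrow> (\<forall>k<n. (\<Sum>c<n. M $$ (k, c) * v c) = 0)" for v
    using assms by (auto simp: vec_eq_iff scalar_prod_def lessThan_atLeast0 intro!: sum.cong)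
  have "det M = 0 \<longleftrightarrow> (\<exists>v. v \<in> carrier_vec n \<and> v \<noteq> 0\<^sub>v n \<and> M *\<^sub>v v = 0\<^sub>v n)"
    using assms by (rule det_0_iff_vec_prod_zero_field)
  also have "\<dots> \<longleftrightarrow> (\<exists>v. vec n v \<noteq> 0\<^sub>v n \<and> M *\<^sub>v vec n v = 0\<^sub>v n)"
  proof
    assume "\<exists>v. v \<in> carrier_vec n \<and> v \<noteq> 0\<^sub>v n \<and> M *\<^sub>v v = 0\<^sub>v n"
    then obtain v where v: "v \<in> carrier_vec n" "v \<noteq> 0\<^sub>v n" "M *\<^sub>v v = 0\<^sub>v n"
      by blast
    have "vec n (($) v) = v"
      using v(1) by auto
    then show "\<exists>v. vec n v \<noteq> 0\<^sub>v n \<and> M *\<^sub>v vec n v = 0\<^sub>v n"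
      using v(2,3) by metis
  qed (metis vec_carrier)
  also have "\<dots> \<longleftrightarrow> (\<exists>v. (\<exists>c<n. v c \<noteq> 0) \<and> (\<forall>k<n. (\<Sum>c<n. M $$ (k, c) * v c) = 0))"
    unfolding mult by (simp add: vec_eq_iff)
  finally show ?thesis
    by blast
qed

subsection \<open>Reduction to the box below \<open>g\<close>\<close>

locale hilbert_determined = hilbert_decomposed scale gr I Z s
  for scale :: "('n::finite, 'k::field) mpoly \<Rightarrow> 'm::ab_group_add \<Rightarrow> 'm" and gr
    and I :: "'i set" and Z s +
  fixes g :: "'n \<Rightarrow> int"
  assumes g_nonneg: "0 \<le> g"
    and determined: "positively_determined scale gr g"
    and s_le_g: "i \<in> I \<Longrightarrow> s i \<le> g"
begin

lemma gr_eq_0: "\<not> 0 \<le> a \<Longrightarrow> gr a = {0}"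
  using determined by (simp add: positively_determined_def)

text \<open>\<open>i\<close> lies in \<open>C (s i)\<close>, so the component of degree
  \<open>s i\<close> is nonzero. With \<open>s_le_g\<close> this puts \<open>s i\<close> into the
  box, where a basis has been chosen.\<close>

lemma s_nonneg: "i \<in> I \<Longrightarrow> 0 \<le> s i"
  using gr_eq_0[of "s i"] gr_eq_0_imp_C_empty[of "s i"] by (auto simp: C_def occurs_def)

text \<open>A variable \<open>k\<close> divides \<open>X^(a - inf a g)\<close> only if
  \<open>g k < a k\<close>; then \<open>inf a g k = g k\<close>, and multiplication by it is
  bijective from there on.\<close>

lemma bij_scale_from_inf:
  assumes "0 \<le> a"
  shows "bij_betw (scale (X_pow (a - inf a g))) (gr (inf a g)) (gr a)"
proof -
  have le: "inf a g \<le> a"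
    by simp
  have "inf a g + mdeg (mexp (a - inf a g)) = a"
    using le by (auto simp: fun_eq_iff le_fun_def)
  moreover have "g k \<le> inf a g k" if "k \<in> Poly_Mapping.keys (mexp (a - inf a g))" for k
    using that by (simp add: in_keys_iff inf_int_def)
  ultimately show ?thesis
    using bij_scale_monomial[OF determined, of "mexp (a - inf a g)" "inf a g"] by (simp add: X_pow_eq)
qed

text \<open>One inclusion holds because \<open>s\<^sub>i \<le> g\<close>; both sets have the dimension of the respective
  component as their cardinality, and these dimensions agree.\<close>

lemma C_inf:
  assumes "0 \<le> a"
  shows "C a = C (inf a g)"
proof (rule card_subset_eq)
  show "C a \<subseteq> C (inf a g)"
  proof
    fix i assume i: "i \<in> C a"
    then have "i \<in> I" "s i \<le> a" "s i \<le> g" and Z: "\<And>k. s i k \<noteq> a k \<Longrightarrow> k \<in> Z i"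
      using s_le_g by (auto simp: C_def occurs_def)
    moreover have "k \<in> Z i" if "s i k \<noteq> inf a g k" for k
    proof (rule Z)
      \<comment> \<open>If \<open>s i k = a k\<close>, then \<open>a k \<le> g k\<close>, so the
        infimum at \<open>k\<close> is \<open>s i k\<close> as well.\<close>
      have "s i k \<le> g k"
        using \<open>s i \<le> g\<close> by (simp add: le_fun_def)
      then show "s i k \<noteq> a k"
        using that by (auto simp: inf_int_def)
    qed
    ultimately show "i \<in> C (inf a g)"
      by (auto simp: C_def occurs_def)
  qed
  let ?X = "scale (X_pow (a - inf a g))"
  interpret X: Vector_Spaces.linear "kscale scale" "kscale scale" ?X
    by (rule linear_scale)
  note bij = bij_scale_from_inf[OF assms]
  obtain \<beta> where \<beta>: "inj_on \<beta> (C (inf a g))" "K.independent (\<beta> ` C (inf a g))"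
      "K.span (\<beta> ` C (inf a g)) = gr (inf a g)"
    by (rule gr_basis)
  have inj: "inj_on ?X (K.span (\<beta> ` C (inf a g)))"
    using bij unfolding \<beta>(3) by (simp add: bij_betw_def)
  have "K.span (?X ` \<beta> ` C (inf a g)) = gr a"
    unfolding X.span_image \<beta>(3) using bij by (simp add: bij_betw_def)
  moreover have "K.independent (?X ` \<beta> ` C (inf a g))"
    by (rule X.independent_injective_image[OF \<beta>(2) inj])
  ultimately have "K.dim (gr a) = card (?X ` \<beta> ` C (inf a g))"
    by (metis K.dim_span_eq_card_independent)
  also have "\<dots> = card (C (inf a g))"
    using \<beta>(1) inj_on_subset[OF inj K.span_superset] by (simp add: card_image)
  finally show "card (C a) = card (C (inf a g))"
    by (simp add: dim_gr)
qed simp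

text \<open>Multiplication by \<open>X^(a - inf a g)\<close> is injective on the lower component and
  carries its terms to those in degree \<open>a\<close>, so a relation in degree \<open>a\<close>
  already holds in degree \<open>inf a g\<close>.\<close>

lemma indep_at_from_inf:
  assumes m: "\<And>i. i \<in> I \<Longrightarrow> m i \<in> gr (s i)" and "0 \<le> a" and ind: "indep_at m (inf a g)"
  shows "indep_at m a"
  unfolding indep_at_def C_inf[OF \<open>0 \<le> a\<close>]
proof (intro allI impI)
  fix v assume v: "(\<Sum>i\<in>C (inf a g). kscale scale (v i) (term_at m a i)) = 0"
  let ?X = "scale (X_pow (a - inf a g))"
  let ?x = "\<Sum>i\<in>C (inf a g). kscale scale (v i) (term_at m (inf a g) i)"
  interpret X: Vector_Spaces.linear "kscale scale" "kscale scale" ?X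
    by (rule linear_scale)
  have "?X (term_at m (inf a g) i) = term_at m a i" if "i \<in> C (inf a g)" for i
  proof -
    have le: "0 \<le> a - inf a g" "0 \<le> inf a g - s i"
      using that by (auto simp: C_def occurs_def le_fun_def)
    have "mexp (a - s i) = mexp (a - inf a g) + mexp (inf a g - s i)"
      using mexp_add[OF le] by simp
    then show ?thesis
      by (simp add: term_at_def X_pow_eq mult_single)
  qed
  then have "?X ?x = ?X 0"
    by (simp add: X.sum X.scale v)
  moreover have "?x \<in> gr (inf a g)"
    using m by (intro K.subspace_sum[OF gr_K_subspace] K.subspace_scale[OF gr_K_subspace] term_at_gr)
      (auto simp: C_def)
  ultimately have "?x = 0"
    using bij_scale_from_inf[OF \<open>0 \<le> a\<close>] by (auto simp: bij_betw_def inj_on_def)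
  then show "\<forall>i\<in>C (inf a g). v i = 0"
    using ind by (simp add: indep_at_def)
qed

lemma indep_at_everywhere:
  assumes "\<And>i. i \<in> I \<Longrightarrow> m i \<in> gr (s i)" "\<And>a. a \<in> {0..g} \<Longrightarrow> indep_at m a"
  shows "indep_at m a"
proof (cases "0 \<le> a")
  case True
  then have "indep_at m (inf a g)"
    using g_nonneg by (intro assms(2)) simp
  with assms(1) True show ?thesis
    by (rule indep_at_from_inf)
next
  case False
  \<comment> \<open>Outside the nonnegative degrees the module vanishes, so nothing occurs and
    independence is vacuous.\<close>
  then have "C a = {}"
    by (intro gr_eq_0_imp_C_empty gr_eq_0)
  then show ?thesis
    by (simp add: indep_at_def)
qed

end

subsection \<open>The determinants\<close>

context hilbert_decomposed
begin

text \<open>The generic element of degree \<open>s i\<close>, with the indeterminates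
  \<open>Y (i, j)\<close> specialised to \<open>y (i, j)\<close>.\<close>

definition generic :: "(('n \<Rightarrow> int) \<Rightarrow> 'm list) \<Rightarrow> ('i \<times> nat \<Rightarrow> 'k) \<Rightarrow> 'i \<Rightarrow> 'm" where
  "generic b y i = (\<Sum>j<length (b (s i)). kscale scale (y (i, j)) (b (s i) ! j))"

lemma generic_gr:
  assumes "k_basis_of scale (gr (s i)) (b (s i))"
  shows "generic b y i \<in> gr (s i)"
proof -
  have "set (b (s i)) \<subseteq> gr (s i)"
    using assms K.span_superset by (auto simp: k_basis_of_def)
  then show ?thesis
    unfolding generic_def
    by (intro K.subspace_sum[OF gr_K_subspace] K.subspace_scale[OF gr_K_subspace]) auto
qed

text \<open>Every element of degree \<open>s i\<close> arises from its coordinates, so the points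
  \<open>y\<close> cover all candidates for \<open>m i\<close>.\<close>

lemma generic_surj:
  assumes "k_basis_of scale (gr (s i)) (b (s i))" "x \<in> gr (s i)"
    and "\<And>j. y (i, j) = K.representation (set (b (s i))) x (b (s i) ! j)"
  shows "generic b y i = x"
proof -
  let ?B = "b (s i)"
  have "x = (\<Sum>z\<in>set ?B. kscale scale (K.representation (set ?B) x z) z)"
    using assms(1,2) by (intro K.sum_representation_eq[symmetric]) (auto simp: k_basis_of_def)
  also have "\<dots> = generic b y i"
    unfolding generic_def assms(3)
    using assms(1) by (intro sum.reindex_bij_betw[symmetric] bij_betw_nth) (auto simp: k_basis_of_def)
  finally show ?thesis ..
qed

text \<open>Coordinates and multiplication by \<open>X^(a - s i)\<close> are linear, so specialising
  an entry of the generic matrix gives the coordinate of the specialised term.\<close>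

lemma poly_eval_A_matrix_entry:
  assumes ba: "k_basis_of scale (gr a) (b a)" and bs: "k_basis_of scale (gr (s i)) (b (s i))"
    and i: "i = cs ! c" "i \<in> C a" and "k < length (b a)" "c < length cs"
  shows "poly_eval y (A_matrix scale b s cs a $$ (k, c))
    = K.representation (set (b a)) (term_at (generic b y) a i) (b a ! k)"
proof -
  have basis: "K.independent (set (b a))" "K.span (set (b a)) = gr a"
    using ba by (auto simp: k_basis_of_def)
  have "b (s i) ! j \<in> gr (s i)" if "j < length (b (s i))" for j
    using bs that K.span_base[of "b (s i) ! j" "set (b (s i))"] by (auto simp: k_basis_of_def)
  then have mem: "scale (X_pow (a - s i)) (b (s i) ! j) \<in> K.span (set (b a))" if "j < length (b (s i))" for j
    using term_at_gr[OF i(2), of "\<lambda>_. b (s i) ! j"] that by (simp add: term_at_def basis)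
  have eq: "term_at (generic b y) a i
      = (\<Sum>j<length (b (s i)). kscale scale (y (i, j)) (scale (X_pow (a - s i)) (b (s i) ! j)))"
    by (simp add: term_at_def generic_def scale_sum_right scale_kscale)
  have "K.representation (set (b a)) (term_at (generic b y) a i) (b a ! k)
      = (\<Sum>j<length (b (s i)). y (i, j) * K.representation (set (b a)) (scale (X_pow (a - s i)) (b (s i) ! j)) (b a ! k))"
    unfolding eq by (rule K.representation_lincomb[OF basis(1) mem]) simp
  then show ?thesis
    using assms(5,6) by (simp add: A_matrix_def Let_def poly_eval_sum poly_eval_mult mult.commute flip: i(1))
qed

text \<open>Evaluation is a ring homomorphism and so commutes with \<open>det\<close>; the evaluated
  columns are the coordinate vectors of the terms in degree \<open>a\<close>.\<close>

lemma poly_eval_det_A_matrix: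
  assumes ba: "k_basis_of scale (gr a) (b a)"
    and bs: "\<And>i. i \<in> C a \<Longrightarrow> k_basis_of scale (gr (s i)) (b (s i))"
    and cs: "distinct cs" "set cs = C a"
  shows "poly_eval y (det (A_matrix scale b s cs a)) \<noteq> 0 \<longleftrightarrow> indep_at (generic b y) a"
proof -
  interpret ev: comm_ring_hom "poly_eval y"
    by (rule comm_ring_hom_poly_eval)
  let ?A = "A_matrix scale b s cs a" and ?w = "term_at (generic b y) a"
  define n where "n = length cs"
  have basis: "K.independent (set (b a))" "K.span (set (b a)) = gr a" "distinct (b a)"
    using ba by (auto simp: k_basis_of_def)
  \<comment> \<open>The dimension count makes the matrix square; the \<open>det\<close> of a
    non-square matrix would be 0 by convention.\<close>
  have len: "length (b a) = n"
    using basis cs dim_gr[of a] by (metis K.dim_span_eq_card_independent distinct_card n_def)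
  have carrier: "map_mat (poly_eval y) ?A \<in> carrier_mat n n"
    by (simp add: A_matrix_def len n_def)
  have cs_C: "cs ! c \<in> C a" if "c < n" for c
    unfolding cs(2)[symmetric] using that by (simp add: n_def)
  have w: "?w (cs ! c) \<in> gr a" if "c < n" for c
    by (intro term_at_gr generic_gr bs cs_C that)
  have entry: "map_mat (poly_eval y) ?A $$ (k, c) = K.representation (set (b a)) (?w (cs ! c)) (b a ! k)"
    if "k < n" "c < n" for k c
    using poly_eval_A_matrix_entry[OF ba bs[OF cs_C] refl cs_C, of c k y] that
    by (simp add: A_matrix_def len n_def)
  have relation: "(\<forall>k<n. (\<Sum>c<n. map_mat (poly_eval y) ?A $$ (k, c) * v c) = 0)
      \<longleftrightarrow> (\<Sum>c<n. kscale scale (v c) (?w (cs ! c))) = 0" for v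
  proof -
    let ?x = "\<Sum>c<n. kscale scale (v c) (?w (cs ! c))"
    have x: "?x \<in> K.span (set (b a))"
      unfolding basis(2)
      by (intro K.subspace_sum[OF gr_K_subspace] K.subspace_scale[OF gr_K_subspace] w) simp
    have rep: "K.representation (set (b a)) ?x (b a ! k)
        = (\<Sum>c<n. v c * K.representation (set (b a)) (?w (cs ! c)) (b a ! k))" for k
      using basis w by (intro K.representation_lincomb) simp_all
    have coord: "(\<Sum>c<n. map_mat (poly_eval y) ?A $$ (k, c) * v c)
        = K.representation (set (b a)) ?x (b a ! k)" if "k < n" for k
      unfolding rep using entry[OF that] by (intro sum.cong) (simp_all only: lessThan_iff mult.commute)
    show ?thesis
    proof
      assume "\<forall>k<n. (\<Sum>c<n. map_mat (poly_eval y) ?A $$ (k, c) * v c) = 0"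
      then have "K.representation (set (b a)) ?x z = 0" if "z \<in> set (b a)" for z
        using that coord len by (auto simp: in_set_conv_nth)
      moreover have "(\<Sum>z\<in>set (b a). kscale scale (K.representation (set (b a)) ?x z) z) = ?x"
        using basis x by (intro K.sum_representation_eq) auto
      ultimately show "?x = 0"
        by simp
    next
      assume "?x = 0"
      then show "\<forall>k<n. (\<Sum>c<n. map_mat (poly_eval y) ?A $$ (k, c) * v c) = 0"
        using coord by (simp add: K.representation_zero)
    qed
  qed
  have bij: "bij_betw ((!) cs) {..<n} (C a)"
    using cs by (intro bij_betw_nth) (auto simp: n_def)
  have "poly_eval y (det ?A) \<noteq> 0 \<longleftrightarrow>
      (\<forall>v. (\<Sum>c<n. kscale scale (v c) (?w (cs ! c))) = 0 \<longrightarrow> (\<forall>c<n. v c = 0))"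
    unfolding ev.hom_det[symmetric] det_nonzero_iff_columns_independent[OF carrier] relation ..
  also have "\<dots> \<longleftrightarrow> indep_at (generic b y) a"
  proof
    assume L: "\<forall>v. (\<Sum>c<n. kscale scale (v c) (?w (cs ! c))) = 0 \<longrightarrow> (\<forall>c<n. v c = 0)"
    show "indep_at (generic b y) a"
      unfolding indep_at_def
    proof (intro allI impI ballI)
      fix v i assume "(\<Sum>i\<in>C a. kscale scale (v i) (?w i)) = 0" "i \<in> C a"
      then have "\<forall>c<n. v (cs ! c) = 0"
        using L[rule_format, of "\<lambda>c. v (cs ! c)"]
          sum.reindex_bij_betw[OF bij, of "\<lambda>i. kscale scale (v i) (?w i)"] by simp
      moreover obtain c where "c < n" "i = cs ! c"
        using \<open>i \<in> C a\<close> cs(2) by (metis in_set_conv_nth n_def)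
      ultimately show "v i = 0"
        by simp
    qed
  next
    assume R: "indep_at (generic b y) a"
    show "\<forall>v. (\<Sum>c<n. kscale scale (v c) (?w (cs ! c))) = 0 \<longrightarrow> (\<forall>c<n. v c = 0)"
    proof (intro allI impI)
      fix v c assume v: "(\<Sum>c<n. kscale scale (v c) (?w (cs ! c))) = 0" and "c < n"
      \<comment> \<open>Coefficients indexed by column numbers are carried over to
        \<open>C a\<close> along the inverse of the enumeration \<open>cs\<close>.\<close>
      define u where "u i = v (inv_into {..<n} ((!) cs) i)" for i
      have u: "u (cs ! c) = v c" if "c < n" for c
        using bij that by (simp add: u_def bij_betw_def inv_into_f_f)
      have "(\<Sum>i\<in>C a. kscale scale (u i) (?w i)) = (\<Sum>c<n. kscale scale (u (cs ! c)) (?w (cs ! c)))"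
        by (rule sum.reindex_bij_betw[OF bij, symmetric])
      also have "\<dots> = 0"
        unfolding v[symmetric] by (intro sum.cong) (simp_all add: u)
      finally have "u (cs ! c) = 0"
        using R cs_C[OF \<open>c < n\<close>] unfolding indep_at_def by blast
      then show "v c = 0"
        using u \<open>c < n\<close> by simp
    qed
  qed
  finally show ?thesis .
qed

end

text \<open>Holds over every field; only the existence of a common non-root will depend on whether
  the field is finite.\<close>

lemma (in hilbert_determined) induced_by_stanley_iff:
  fixes cols :: "('n \<Rightarrow> int) \<Rightarrow> 'i list"
  assumes b: "\<And>a. a \<in> {0..g} \<Longrightarrow> k_basis_of scale (gr a) (b a)"
    and cols: "\<And>a. a \<in> {0..g} \<Longrightarrow> distinct (cols a) \<and> set (cols a) = C a"
  shows "induced_by_stanley scale gr I Z s \<longleftrightarrow>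
    (\<exists>y. \<forall>a\<in>{0..g}. poly_eval y (det (A_matrix scale b s (cols a) a)) \<noteq> 0)"
proof -
  have bs: "k_basis_of scale (gr (s i)) (b (s i))" if "i \<in> I" for i
    using that s_nonneg s_le_g by (intro b) simp
  have det: "poly_eval y (det (A_matrix scale b s (cols a) a)) \<noteq> 0 \<longleftrightarrow> indep_at (generic b y) a"
    if "a \<in> {0..g}" for a y
    using that b cols bs by (intro poly_eval_det_A_matrix) (auto simp: C_def)
  show ?thesis
  proof
    assume "induced_by_stanley scale gr I Z s"
    then obtain m where m: "stanley_decomposition scale gr I Z m" "\<And>i. i \<in> I \<Longrightarrow> m i \<in> gr (s i)"
      by (auto simp: induced_by_stanley_def)
    \<comment> \<open>The point is read off from the given generators: its entries are the
      coordinates of the \<open>m i\<close> in the chosen bases.\<close>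
    define y where "y = (\<lambda>(i, j). K.representation (set (b (s i))) (m i) (b (s i) ! j))"
    have gen: "generic b y i = m i" if "i \<in> I" for i
      using that m(2) bs by (intro generic_surj) (auto simp: y_def)
    have "indep_at m a" for a
      using stanley_decomposition_iff[of m] m by simp
    moreover have "term_at (generic b y) a i = term_at m a i" if "i \<in> C a" for a i
      using that gen by (simp add: term_at_def C_def)
    ultimately have "indep_at (generic b y) a" for a
      by (simp add: indep_at_def cong: sum.cong)
    then show "\<exists>y. \<forall>a\<in>{0..g}. poly_eval y (det (A_matrix scale b s (cols a) a)) \<noteq> 0"
      using det by blast
  next
    assume "\<exists>y. \<forall>a\<in>{0..g}. poly_eval y (det (A_matrix scale b s (cols a) a)) \<noteq> 0"
    then obtain y where box: "\<And>a. a \<in> {0..g} \<Longrightarrow> indep_at (generic b y) a"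
      using det by blast
    have gr: "generic b y i \<in> gr (s i)" if "i \<in> I" for i
      by (rule generic_gr) (rule bs[OF that])
    have "indep_at (generic b y) a" for a
      by (rule indep_at_everywhere) (fact gr, fact box)
    then have "stanley_decomposition scale gr I Z (generic b y)"
      using stanley_decomposition_iff[of "generic b y"] gr by simp
    then show "induced_by_stanley scale gr I Z s"
      unfolding induced_by_stanley_def using gr by blast
  qed
qed

text \<open>A product over an infinite index set is 1 by default, so finiteness of the box lets
  evaluation of \<open>P\<close> test every determinant; the search for a common non-root needs it
  too.\<close>

lemma finite_int_box: "finite {a..b :: 'n::finite \<Rightarrow> int}"
proof (rule finite_subset)
  show "{a..b} \<subseteq> PiE UNIV (\<lambda>k. {a k..b k})"
    by (auto simp: le_fun_def)
qed (simp add: finite_PiE)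

theorem theorem3p4:
  fixes scale :: "('n::finite, 'k::field) mpoly \<Rightarrow> 'm::ab_group_add \<Rightarrow> 'm"
    and gr :: "('n \<Rightarrow> int) \<Rightarrow> 'm set"
    and g :: "'n \<Rightarrow> int"
    and I :: "'i set"
    and Z :: "'i \<Rightarrow> 'n set"
    and s :: "'i \<Rightarrow> 'n \<Rightarrow> int"
    and b :: "('n \<Rightarrow> int) \<Rightarrow> 'm list"
    and cols :: "('n \<Rightarrow> int) \<Rightarrow> 'i list"
    and A :: "('n \<Rightarrow> int) \<Rightarrow> ('i \<times> nat, 'k) mpoly mat"
  assumes "graded_module scale gr"
    and "finitely_generated scale"
    and "0 \<le> g"
    and "positively_determined scale gr g"
    and "hilbert_decomposition scale gr I Z s"
    and "\<forall>i\<in>I. s i \<le> g"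
    and "\<forall>a\<in>{0..g}. k_basis_of scale (gr a) (b a)"
    and "\<forall>a\<in>{0..g}. distinct (cols a) \<and> set (cols a) = occurring TYPE('k) I Z s a"
    and "\<forall>a\<in>{0..g}. A a = A_matrix scale b s (cols a) a"
  shows "(infinite (UNIV :: 'k set) \<longrightarrow>
            (induced_by_stanley scale gr I Z s \<longleftrightarrow>
               (\<forall>a\<in>{0..g}. Determinant.det (A a) \<noteq> 0))) \<and>
         (\<forall>q P. finite (UNIV :: 'k set) \<longrightarrow> card (UNIV :: 'k set) = q \<longrightarrow>
            P = (\<Prod>a\<in>{0..g}. Determinant.det (A a)) \<longrightarrow>
            (induced_by_stanley scale gr I Z s \<longleftrightarrow> reduce_poly q P \<noteq> 0))"
proof -
  interpret graded_module scale gr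
    by fact
  interpret hilbert_determined scale gr I Z s g
    using assms by unfold_locales auto
  have "induced_by_stanley scale gr I Z s \<longleftrightarrow>
      (\<exists>y. \<forall>a\<in>{0..g}. poly_eval y (det (A_matrix scale b s (cols a) a)) \<noteq> 0)"
    using assms(7,8) by (intro induced_by_stanley_iff) (auto simp: C_def occurring_eq)
  also have "\<dots> \<longleftrightarrow> (\<exists>y. \<forall>a\<in>{0..g}. poly_eval y (det (A a)) \<noteq> 0)"
    using assms(9) by simp
  finally have main: "induced_by_stanley scale gr I Z s \<longleftrightarrow>
      (\<exists>y. \<forall>a\<in>{0..g}. poly_eval y (det (A a)) \<noteq> 0)" .
  show ?thesis
  proof (intro conjI impI allI)
    assume inf: "infinite (UNIV :: 'k set)"
    show "induced_by_stanley scale gr I Z s \<longleftrightarrow> (\<forall>a\<in>{0..g}. det (A a) \<noteq> 0)"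
      unfolding main
    proof
      assume "\<forall>a\<in>{0..g}. det (A a) \<noteq> 0"
      then obtain y where "\<And>a. a \<in> {0..g} \<Longrightarrow> poly_eval y (det (A a)) \<noteq> 0"
        using poly_eval_nonzero_infinite[OF inf finite_int_box[of 0 g], of "\<lambda>a. det (A a)"] by blast
      then show "\<exists>y. \<forall>a\<in>{0..g}. poly_eval y (det (A a)) \<noteq> 0"
        by blast
    qed (metis poly_eval_0)
  next
    fix q and P :: "('i \<times> nat, 'k) mpoly"
    assume "finite (UNIV :: 'k set)" "card (UNIV :: 'k set) = q" "P = (\<Prod>a\<in>{0..g}. det (A a))"
    \<comment> \<open>A field has no zero divisors, so a point is a common non-root of the
      determinants iff their product does not vanish there.\<close>
    then show "induced_by_stanley scale gr I Z s \<longleftrightarrow> reduce_poly q P \<noteq> 0"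
      unfolding main using reduce_poly_nonzero_iff[of P]
      by (auto simp: poly_eval_prod finite_int_box)
  qed
qed

end
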